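(* Let $(X,d)$ be a complete metric space, let $h\colon[0,\infty)\to[0,\infty)$ be a nondecreasing continuous function with $h(t)>0$ for all $t>0$, and let $\mu\in\mathscr P(X)$. Then the following conditions are equivalent. (1) The set $\operatorname{supp}\mu$ is compact, and for every $x,y\in\operatorname{supp}\mu$ with $x\ne y$ there exist $N\in\mathbb N$ and a sequence $(z_i)_{i=0}^{N+1}\subset\operatorname{supp}\mu$ such that $z_0=x$, $z_{N+1}=y$ and $$\sum_{i=0}^N h(d(z_i,z_{i+1}))<h(d(x,y)).$$ (2) There exists a nondecreasing function $\omega\colon[0,\infty)\to[0,\infty)$ with $\omega(t)>0$ for all $t>0$ such that the following holds: for every $\nu\in\mathscr P(\operatorname{supp}\mu)$ and every transport plan $\lambda\in\Pi(\mu,\nu)$ that minimizes the functional $C_h\colon\Pi(\mu,\nu)\to[0,\infty]$, $C_h(\tilde\lambda)=\int_{X\times X}h(d(x,y))\,\mathrm{d}\tilde\lambda(x,y)$, one has $$\int_{X\times X}h(d(x,y))\,\mathrm{d}\lambda(x,y)\ \ge\ \omega\Big(\lambda\text{-}\operatorname{ess\,sup}_{(x,y)\in X^2}d(x,y)\Big).\qquad( ** )$$ Moreover, if (1) holds, then one can take as $\omega$ in $( ** )$ the function $\omega(t)=m(\rho(t)/4)\,h(\rho(t)/4)$, where $m(t):=\inf_{x\in\operatorname{supp}\mu}\mu(B(x,t))$ and $\rho\colon[0,\infty)\to[0,\infty)$, with $\rho(t)>0$ for all $t>0$, satisfies the following slightly stronger version of the inequality in (1): for every $x,y\in\operatorname{supp}\mu$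 with $x\neq y$ there exist $N\in\mathbb N$ and a sequence $(z_i)_{i=0}^{N+1}\subset\operatorname{supp}\mu$ such that $z_0=x$, $z_{N+1}=y$ and $$\sum_{i=0}^N h\big(d(z_i,z_{i+1})+\rho(d(x,y))\big)<h(d(x,y)).$$
   Context: $\mathscr P(X)$ is the set of Borel probability measures on $X$. $\operatorname{supp}\mu$ is the support of $\mu$, i.e. the set of $x\in X$ with $\mu(B(x,r))>0$ for all $r>0$. $\mathscr P(\operatorname{supp}\mu)$ denotes the Borel probability measures living on $\operatorname{supp}\mu$. $B(x,r)$ is the open ball of center $x$ and radius $r$. $\Pi(\mu,\nu)$ is the set of transport plans, i.e. Borel probability measures on $X\times X$ with first marginal $\mu$ and second marginal $\nu$. $\lambda\text{-}\operatorname{ess\,sup}$ is the essential supremum with respect to $\lambda$.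
   Formalization: Added: h(0)=0 (else (2) holds trivially with constant ω=h(0)); ρ(0)=0 (else ν=μ violates ( ** )); μ(supp μ)=1 (automatic for separable X). Every such ρ gives ( ** ), but ω is claimed nondecreasing only for some ρ. ω(∞) means sup ω. *)

theory Defs
  imports "HOL-Probability.Probability" "HOL-Probability.Essential_Supremum"
begin

definition borel_prob :: "'a::topological_space measure \<Rightarrow> bool" where
  "borel_prob \<mu> \<longleftrightarrow> prob_space \<mu> \<and> sets \<mu> = sets borel"

definition supp :: "'a::metric_space measure \<Rightarrow> 'a set" where
  "supp \<mu> = {x. \<forall>r>0. measure \<mu> (ball x r) > 0}"

lemma closed_supp:
  fixes \<mu> :: "'a::metric_space measure"
  assumes "borel_prob \<mu>"
  shows "closed (supp \<mu>)"
proof -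
  interpret prob_space \<mu> using assms by (simp add: borel_prob_def)
  have "\<exists>e>0. ball x e \<subseteq> - supp \<mu>" if x: "x \<notin> supp \<mu>" for x
  proof -
    obtain r where r: "r > 0" "\<not> measure \<mu> (ball x r) > 0"
      using x unfolding supp_def by blast
    have "y \<notin> supp \<mu>" if y: "y \<in> ball x r" for y
    proof -
      have "ball y (r - dist x y) \<subseteq> ball x r"
        by (rule subsetI, simp, smt (verit) dist_triangle)
      then have "measure \<mu> (ball y (r - dist x y)) \<le> measure \<mu> (ball x r)"
        using assms by (intro finite_measure_mono) (auto simp: borel_prob_def)
      then show ?thesis
        using r(2) y by (auto simp: supp_def intro!: exI[of _ "r - dist x y"])
    qed
    then show ?thesis using r(1) by blast
  qed
  then show ?thesis
    by (auto simp: closed_def open_contains_ball)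
qed

text \<open>
  On a nonseparable metric space a Borel probability measure can give mass to the complement of
  its support (if real-valued measurable cardinals exist).  The next lemma shows that this is
  impossible on separable spaces.
\<close>

lemma emeasure_supp:
  fixes \<mu> :: "'a::{metric_space, second_countable_topology} measure"
  assumes "borel_prob \<mu>"
  shows "emeasure \<mu> (supp \<mu>) = 1"
proof -
  interpret prob_space \<mu> using assms by (simp add: borel_prob_def)
  have S: "sets \<mu> = sets borel" using assms by (simp add: borel_prob_def)
  have sp: "space \<mu> = UNIV" using sets_eq_imp_space_eq[OF S] by simp
  define F where "F = {ball x r | x r. r > 0 \<and> measure \<mu> (ball x r) = 0}"
  have "\<Union>F = - supp \<mu>"
  proof
    show "- supp \<mu> \<subseteq> \<Union>F"
      by (force simp: F_def supp_def zero_less_measure_iff)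
    show "\<Union>F \<subseteq> - supp \<mu>"
    proof
      fix y assume "y \<in> \<Union>F"
      then obtain x r where xr: "y \<in> ball x r" "measure \<mu> (ball x r) = 0" by (auto simp: F_def)
      have "ball y (r - dist x y) \<subseteq> ball x r"
        by (rule subsetI, simp, smt (verit) dist_triangle)
      then have "measure \<mu> (ball y (r - dist x y)) \<le> measure \<mu> (ball x r)"
        using S by (intro finite_measure_mono) auto
      then show "y \<in> - supp \<mu>"
        using xr by (auto simp: supp_def intro!: exI[of _ "r - dist x y"])
    qed
  qed
  moreover obtain F' where F': "F' \<subseteq> F" "countable F'" "\<Union>F' = \<Union>F"
    using Lindelof[of F] by (auto simp: F_def)
  have "(\<Union>B\<in>F'. B) \<in> null_sets \<mu>"
    using F'(1,2) S by (intro null_sets_UN') (auto simp: F_def emeasure_eq_measure null_sets_def)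
  ultimately have "- supp \<mu> \<in> null_sets \<mu>" using F'(3) by simp
  then have "AE x in \<mu>. x \<in> supp \<mu>"
    by (rule AE_I') auto
  moreover have "supp \<mu> \<in> sets \<mu>"
    using closed_supp[OF assms] S by simp
  ultimately show ?thesis by (simp add: emeasure_eq_1_AE)
qed

definition probs_on :: "'a::topological_space set \<Rightarrow> 'a measure set" where
  "probs_on S = {\<nu>. borel_prob \<nu> \<and> emeasure \<nu> S = 1}"

text \<open>
  Plans are measures on the Borel sets of the product space, not on the product of the Borel
  sigma-algebras, which is smaller when the space is not separable.
\<close>

definition plans ::
  "'a::topological_space measure \<Rightarrow> 'a measure \<Rightarrow> ('a \<times> 'a) measure set" where
  "plans \<mu> \<nu> = {\<gamma>. borel_prob \<gamma> \<and> distr \<gamma> borel fst = \<mu> \<and> distr \<gamma> borel snd = \<nu>}"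

definition transport_cost :: "(real \<Rightarrow> real) \<Rightarrow> ('a::metric_space \<times> 'a) measure \<Rightarrow> ennreal" where
  "transport_cost h \<gamma> = (\<integral>\<^sup>+ (x, y). ennreal (h (dist x y)) \<partial>\<gamma>)"

definition optimal_plan ::
  "(real \<Rightarrow> real) \<Rightarrow> 'a::metric_space measure \<Rightarrow> 'a measure \<Rightarrow> ('a \<times> 'a) measure \<Rightarrow> bool" where
  "optimal_plan h \<mu> \<nu> \<gamma> \<longleftrightarrow>
     \<gamma> \<in> plans \<mu> \<nu> \<and> (\<forall>\<gamma>'\<in>plans \<mu> \<nu>. transport_cost h \<gamma> \<le> transport_cost h \<gamma>')"

definition ess_dist :: "('a::metric_space \<times> 'a) measure \<Rightarrow> ennreal" where
  "ess_dist \<gamma> = esssup \<gamma> (\<lambda>(x, y). ennreal (dist x y))"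

text \<open>
  The essential supremum may be infinite when the support is unbounded; a nondecreasing function
  on the half-line is then evaluated at infinity as its limit, i.e. its supremum.
\<close>

definition eval_ext :: "(real \<Rightarrow> real) \<Rightarrow> ennreal \<Rightarrow> ennreal" where
  "eval_ext \<omega> s =
     (if s = \<infinity> then (SUP t\<in>{0..}. ennreal (\<omega> t)) else ennreal (\<omega> (enn2real s)))"

text \<open>
  Functions from the nonnegative reals to themselves are represented by functions on the reals
  of which only the values on the nonnegative reals matter.
\<close>

definition gauge_fun :: "(real \<Rightarrow> real) \<Rightarrow> bool" where
  "gauge_fun \<omega> \<longleftrightarrow> mono_on {0..} \<omega> \<and> (\<forall>t\<ge>0. 0 \<le> \<omega> t) \<and> (\<forall>t>0. 0 < \<omega> t)"

definition linfty_estimate ::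
  "(real \<Rightarrow> real) \<Rightarrow> 'a::metric_space measure \<Rightarrow> (real \<Rightarrow> real) \<Rightarrow> bool" where
  "linfty_estimate h \<mu> \<omega> \<longleftrightarrow>
     (\<forall>\<nu>\<in>probs_on (supp \<mu>). \<forall>\<gamma>. optimal_plan h \<mu> \<nu> \<gamma> \<longrightarrow>
        transport_cost h \<gamma> \<ge> eval_ext \<omega> (ess_dist \<gamma>))"

definition is_chain :: "'a set \<Rightarrow> 'a \<Rightarrow> 'a \<Rightarrow> nat \<Rightarrow> (nat \<Rightarrow> 'a) \<Rightarrow> bool" where
  "is_chain S x y N z \<longleftrightarrow> (\<forall>i\<le>N + 1. z i \<in> S) \<and> z 0 = x \<and> z (N + 1) = y"

definition chain_condition :: "(real \<Rightarrow> real) \<Rightarrow> 'a::metric_space set \<Rightarrow> bool" where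
  "chain_condition h S \<longleftrightarrow>
     (\<forall>x\<in>S. \<forall>y\<in>S. x \<noteq> y \<longrightarrow>
        (\<exists>N z. is_chain S x y N z \<and> (\<Sum>i=0..N. h (dist (z i) (z (i + 1)))) < h (dist x y)))"

text \<open>
  The value at 0 is taken to be 0: since the cost vanishes at 0, the estimate for the
  identity plan forces the induced modulus to vanish at 0.
\<close>

definition chain_slack ::
  "(real \<Rightarrow> real) \<Rightarrow> 'a::metric_space set \<Rightarrow> (real \<Rightarrow> real) \<Rightarrow> bool" where
  "chain_slack h S \<rho> \<longleftrightarrow>
     \<rho> 0 = 0 \<and> (\<forall>t>0. 0 < \<rho> t) \<and>
     (\<forall>x\<in>S. \<forall>y\<in>S. x \<noteq> y \<longrightarrow>
        (\<exists>N z. is_chain S x y N z \<and>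
           (\<Sum>i=0..N. h (dist (z i) (z (i + 1)) + \<rho> (dist x y))) < h (dist x y)))"

definition min_ball_mass :: "'a::metric_space measure \<Rightarrow> real \<Rightarrow> real" where
  "min_ball_mass \<mu> t = (INF x\<in>supp \<mu>. measure \<mu> (ball x t))"

definition slack_modulus ::
  "(real \<Rightarrow> real) \<Rightarrow> 'a::metric_space measure \<Rightarrow> (real \<Rightarrow> real) \<Rightarrow> real \<Rightarrow> real" where
  "slack_modulus h \<mu> \<rho> t = min_ball_mass \<mu> (\<rho> t / 4) * h (\<rho> t / 4)"

end

theory Submission
  imports Defs
begin

text \<open>
  Write \<open>S\<close> for the support of \<open>\<mu>\<close>.

  Suppose first that \<open>S\<close> is compact and that its chains have slack \<open>\<rho>\<close>.  Let \<open>\<gamma>\<close> be optimal and let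
  \<open>s\<close> be its essential supremum of distances.  By compactness \<open>s\<close> is the distance of a pair
  \<open>(x, y)\<close> in the support of \<open>\<gamma>\<close> (lemma \<open>ex_extremal_pair\<close>).  Join \<open>x\<close> to \<open>y\<close> by a chain \<open>z\<close> with
  slack \<open>\<rho> s\<close>.  If the cost of \<open>\<gamma>\<close> were below \<open>m (\<rho> s / 4) * h (\<rho> s / 4)\<close>, where \<open>m\<close> is the minimal
  mass of a ball, then by Markov's inequality some mass that starts within \<open>\<rho> s / 4\<close> of \<open>z i\<close> would
  be moved by less than \<open>\<rho> s / 4\<close>, for each \<open>i\<close>.  Take equal small amounts of mass from these sets
  and from a neighbourhood of \<open>(x, y)\<close>, and permute the targets cyclically: mass near \<open>z i\<close> goes
  to the old targets near \<open>z (i + 1)\<close>.  The marginals stay the same, each new distance exceeds the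
  step of the chain by at most \<open>\<rho> s\<close>, and so the slack makes the new plan strictly cheaper, which
  is absurd (lemmas \<open>optimal_plan_cyclic\<close> and \<open>slack_modulus_estimate\<close>).  A nondecreasing
  slack exists by compactness, since a chain that is strictly cheaper than the direct move stays so
  when its end points move a little (lemmas \<open>uniform_slack\<close> and \<open>ex_mono_slack\<close>).

  For the converse the estimate is tested on explicit optimal plans that move mass to one point
  \<open>y\<close> of \<open>S\<close> and leave the rest in place.  Let \<open>f\<close> be bounded with \<open>f u - f v \<le> h (dist u v)\<close> on \<open>S\<close>.
  Moving to \<open>y\<close> exactly the points where the excess \<open>h (dist u y) - f u\<close> is below a level \<open>a\<close>, and any
  fraction of those where it equals \<open>a\<close>, is optimal by linear duality.  Hence
  \<open>\<omega> t\<close> is at most the cost of this collapse as soon as it moves some mass by \<open>t\<close> or more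
  (lemma \<open>collapse_bound\<close>).  Letting the level decrease, or the fraction tend to \<open>0\<close>, removes
  the cost of the mass on the last level.  Three choices of \<open>f\<close> then give all that is needed.
  \<^item> If \<open>S\<close> were the union of two nonempty parts \<open>C\<close> and \<open>D\<close> at positive distance, take \<open>f = H\<close> on \<open>C\<close>
    and \<open>f = 0\<close> elsewhere, \<open>H\<close> being the infimum of the costs between the parts.  For \<open>y\<close> in \<open>D\<close> almost
    closest to \<open>C\<close> the collapse is arbitrarily cheap but crosses the gap (lemma \<open>no_gap\<close>).
  \<^item> For \<open>f = 0\<close> the plan collapses a ball onto its centre.  If the mass of the ball is small, the
    estimate forces almost all of it to be concentrated near the centre, which produces a gap.  So
    balls of given radius have mass bounded from below, and \<open>S\<close> is totally bounded
    (lemmas \<open>ball_mass_bounded_below\<close> and \<open>supp_totally_bounded\<close>).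
  \<^item> If \<open>x\<close> and \<open>y\<close> violate the chain condition, let \<open>f u\<close> be the infimum of the costs of chains from
    \<open>u\<close> to \<open>y\<close>, truncated at \<open>h (dist x y)\<close>.  Then the excess has its minimum \<open>0\<close> at \<open>x\<close>, and mass
    can be moved over a fixed distance at arbitrarily small cost (lemma \<open>chain_condition_supp\<close>).
\<close>

section \<open>Borel probability measures and transport plans\<close>

lemma borel_probD:
  assumes "borel_prob \<mu>"
  shows "prob_space \<mu>" "sets \<mu> = sets borel" "space \<mu> = UNIV"
  using assms sets_eq_imp_space_eq[of \<mu> borel] by (auto simp: borel_prob_def)

lemma borel_prob_distr:
  assumes "borel_prob \<mu>" "T \<in> borel \<rightarrow>\<^sub>M borel"
  shows "borel_prob (distr \<mu> borel T)"
  using assms by (auto simp: borel_prob_def intro!: prob_space.prob_space_distr)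

lemma AE_in_of_emeasure_1:
  assumes "borel_prob \<mu>" "S \<in> sets borel" "emeasure \<mu> S = 1"
  shows "AE x in \<mu>. x \<in> S"
proof -
  interpret prob_space \<mu> using assms(1) by (rule borel_probD)
  show ?thesis
    using assms by (subst AE_in_set_eq_1) (auto simp: borel_probD emeasure_eq_measure)
qed

lemma measure_eq_0_of_AE:
  assumes "borel_prob \<mu>" "A \<in> sets borel" "AE x in \<mu>. x \<notin> A"
  shows "measure \<mu> A = 0"
  using assms AE_iff_null_sets[of A \<mu>] by (simp add: borel_probD(2) measure_eq_0_null_sets)

lemma borel_measurable_fst_snd [measurable]:
  "fst \<in> (borel :: ('a::topological_space \<times> 'b::topological_space) measure) \<rightarrow>\<^sub>M borel"
  "snd \<in> (borel :: ('a::topological_space \<times> 'b::topological_space) measure) \<rightarrow>\<^sub>M borel"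
  by (auto intro!: borel_measurable_continuous_onI continuous_intros)

lemma plansD:
  assumes "\<gamma> \<in> plans \<mu> \<nu>"
  shows "borel_prob \<gamma>" "borel_prob \<mu>" "borel_prob \<nu>"
    "distr \<gamma> borel fst = \<mu>" "distr \<gamma> borel snd = \<nu>"
proof -
  show 1: "borel_prob \<gamma>" and 2: "distr \<gamma> borel fst = \<mu>" and 3: "distr \<gamma> borel snd = \<nu>"
    using assms by (auto simp: plans_def)
  show "borel_prob \<mu>" "borel_prob \<nu>"
    using borel_prob_distr[OF 1, of fst] borel_prob_distr[OF 1, of snd] 2 3
    by (auto simp: borel_measurable_fst_snd)
qed

text \<open>
  Both marginals of the plans constructed below are computed as integrals of indicators, because
  these plans are sums or mixtures of measures, for which only the integrals are explicit.
\<close>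

lemma plansI:
  assumes "borel_prob \<mu>" "borel_prob \<nu>" "sets \<gamma> = sets borel"
    and fst: "\<And>A. A \<in> sets borel \<Longrightarrow> (\<integral>\<^sup>+p. indicator A (fst p) \<partial>\<gamma>) = emeasure \<mu> A"
    and snd: "\<And>A. A \<in> sets borel \<Longrightarrow> (\<integral>\<^sup>+p. indicator A (snd p) \<partial>\<gamma>) = emeasure \<nu> A"
  shows "\<gamma> \<in> plans \<mu> \<nu>"
proof -
  have sp: "space \<gamma> = UNIV" using sets_eq_imp_space_eq[OF assms(3)] by simp
  have m: "fst \<in> \<gamma> \<rightarrow>\<^sub>M borel" "snd \<in> \<gamma> \<rightarrow>\<^sub>M borel"
    by (simp_all add: measurable_cong_sets[OF assms(3) refl] borel_measurable_fst_snd)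
  have e: "emeasure (distr \<gamma> borel f) A = (\<integral>\<^sup>+p. indicator A (f p) \<partial>\<gamma>)"
    if "A \<in> sets borel" "f \<in> \<gamma> \<rightarrow>\<^sub>M borel" for A :: "'a set" and f
    using that nn_integral_distr[of f \<gamma> borel "indicator A"] by simp
  have "distr \<gamma> borel fst = \<mu>" "distr \<gamma> borel snd = \<nu>"
    by (rule measure_eqI; simp add: e m fst snd borel_probD assms)+
  moreover have "emeasure \<gamma> UNIV = 1"
    using fst[of UNIV] prob_space.emeasure_space_1[OF borel_probD(1)[OF assms(1)]]
    by (simp add: borel_probD(3)[OF assms(1)] sp)
  ultimately show ?thesis
    by (auto simp: plans_def borel_prob_def assms(3) sp intro!: prob_spaceI)
qed

lemma plans_AE_fst:
  assumes "\<gamma> \<in> plans \<mu> \<nu>" "S \<in> sets borel" "AE x in \<mu>. x \<in> S"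
  shows "AE p in \<gamma>. fst p \<in> S"
proof -
  have "AE x in distr \<gamma> borel fst. x \<in> S"
    unfolding plansD(4)[OF assms(1)] by (rule assms(3))
  moreover have "fst \<in> \<gamma> \<rightarrow>\<^sub>M borel"
    by (simp add: measurable_cong_sets[OF borel_probD(2)[OF plansD(1)[OF assms(1)]] refl]
        borel_measurable_fst_snd)
  ultimately show ?thesis using assms(2) by (subst (asm) AE_distr_iff) auto
qed

lemma plans_AE_snd:
  assumes "\<gamma> \<in> plans \<mu> \<nu>" "S \<in> sets borel" "AE x in \<nu>. x \<in> S"
  shows "AE p in \<gamma>. snd p \<in> S"
proof -
  have "AE x in distr \<gamma> borel snd. x \<in> S"
    unfolding plansD(5)[OF assms(1)] by (rule assms(3))
  moreover have "snd \<in> \<gamma> \<rightarrow>\<^sub>M borel"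
    by (simp add: measurable_cong_sets[OF borel_probD(2)[OF plansD(1)[OF assms(1)]] refl]
        borel_measurable_fst_snd)
  ultimately show ?thesis using assms(2) by (subst (asm) AE_distr_iff) auto
qed

text \<open>
  The sum of finitely many measures is their bind along the counting measure of the index set.
\<close>

lemma ex_measure_sum:
  fixes M :: "'i \<Rightarrow> 'a::topological_space measure"
  assumes "finite I" "I \<noteq> {}" "\<And>i. i \<in> I \<Longrightarrow> subprob_space (M i)"
    and "\<And>i. i \<in> I \<Longrightarrow> sets (M i) = sets borel"
  shows "\<exists>K. sets K = sets borel \<and>
    (\<forall>f\<in>borel_measurable borel. (\<integral>\<^sup>+x. f x \<partial>K) = (\<Sum>i\<in>I. \<integral>\<^sup>+x. f x \<partial>M i))"
proof (intro exI conjI ballI)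
  let ?K = "count_space I \<bind> M"
  have M: "M \<in> count_space I \<rightarrow>\<^sub>M subprob_algebra borel"
    using assms by (auto simp: space_subprob_algebra)
  show "sets ?K = sets borel"
    using assms by (intro sets_bind) auto
  fix f :: "'a \<Rightarrow> ennreal" assume f: "f \<in> borel_measurable borel"
  show "(\<integral>\<^sup>+x. f x \<partial>?K) = (\<Sum>i\<in>I. \<integral>\<^sup>+x. f x \<partial>M i)"
    by (simp add: nn_integral_bind[OF f M] nn_integral_count_space_finite assms(1))
qed

text \<open>
  The product measure lives on the product of the Borel sigma-algebras, which can be smaller than
  the Borel sigma-algebra of the product space.  Redirecting the points outside \<open>S \<times> S\<close> to a fixed
  point of \<open>S \<times> S\<close> makes the identity Borel measurable: as \<open>S\<close> is separable, the trace of an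
  open set on \<open>S \<times> S\<close> is a countable union of boxes.  The redirection changes a null set only.
\<close>

lemma ex_coupling:
  fixes \<alpha> \<beta> :: "'a::metric_space measure"
  assumes "borel_prob \<alpha>" "borel_prob \<beta>" "S \<in> sets borel"
    and "AE x in \<alpha>. x \<in> S" "AE x in \<beta>. x \<in> S"
    and D: "countable D" "S \<subseteq> closure D"
  shows "\<exists>\<pi>. \<pi> \<in> plans \<alpha> \<beta>"
proof -
  interpret A: prob_space \<alpha> using assms(1) by (rule borel_probD)
  interpret B: prob_space \<beta> using assms(2) by (rule borel_probD)
  interpret AB: pair_prob_space \<alpha> \<beta> ..
  note [measurable_cong] = borel_probD(2)[OF assms(1)] borel_probD(2)[OF assms(2)]
  note [measurable] = assms(3)
  have "S \<noteq> {}" using assms(4) A.AE_False by auto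
  then obtain s where s: "s \<in> S" by auto
  define g where "g p = (if p \<in> S \<times> S then p else (s, s))" for p
  have g: "g \<in> \<alpha> \<Otimes>\<^sub>M \<beta> \<rightarrow>\<^sub>M borel"
  proof (rule borel_measurableI)
    fix U :: "('a \<times> 'a) set" assume U: "open U"
    define I where "I = {(a, b, q). a \<in> D \<and> b \<in> D \<and> q \<in> \<rat> \<and> ball a q \<times> ball b q \<subseteq> U}"
    have "countable (D \<times> D \<times> (\<rat> :: real set))"
      using D countable_rat by auto
    then have I: "countable I"
      by (rule countable_subset[rotated]) (auto simp: I_def)
    have eq: "U \<inter> S \<times> S = (\<Union>(a, b, q)\<in>I. ball a q \<times> ball b q) \<inter> S \<times> S" (is "_ = ?V \<inter> _")
    proof (intro equalityI subsetI)
      fix p assume p: "p \<in> U \<inter> S \<times> S"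
      obtain x y where xy: "p = (x, y)" by (cases p)
      obtain X Y where "open X" "open Y" "x \<in> X" "y \<in> Y" "X \<times> Y \<subseteq> U"
        using open_prod_elim[OF U, of p] p xy by (metis IntD1 mem_Sigma_iff)
      then obtain d e where de: "d > 0" "e > 0" "ball x d \<subseteq> X" "ball y e \<subseteq> Y"
        by (meson open_contains_ball)
      obtain q where q: "q \<in> \<rat>" "0 < q" "q < min d e / 2"
        using Rats_dense_in_real[of 0 "min d e / 2"] de by auto
      obtain a where a: "a \<in> D" "dist a x < q"
        using closure_approachable[of x D] D p q xy by auto
      obtain b where b: "b \<in> D" "dist b y < q"
        using closure_approachable[of y D] D p q xy by auto
      have "ball a q \<subseteq> ball x d"
      proof
        fix z assume "z \<in> ball a q"
        then show "z \<in> ball x d"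
          using a q dist_triangle[of x z a] by (simp add: dist_commute)
      qed
      moreover have "ball b q \<subseteq> ball y e"
      proof
        fix z assume "z \<in> ball b q"
        then show "z \<in> ball y e"
          using b q dist_triangle[of y z b] by (simp add: dist_commute)
      qed
      ultimately have "(a, b, q) \<in> I"
        using \<open>X \<times> Y \<subseteq> U\<close> de a b q unfolding I_def by blast
      then show "p \<in> ?V \<inter> S \<times> S" using p a b xy by force
    qed (auto simp: I_def)
    have "?V \<inter> S \<times> S \<in> sets (borel \<Otimes>\<^sub>M borel)"
      using I by (intro sets.Int sets.countable_UN') auto
    then have *: "U \<inter> S \<times> S \<in> sets (\<alpha> \<Otimes>\<^sub>M \<beta>)"
      using eq sets_pair_measure_cong[OF borel_probD(2)[OF assms(1)] borel_probD(2)[OF assms(2)]]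
      by simp
    have "g -` U \<inter> space (\<alpha> \<Otimes>\<^sub>M \<beta>) =
        (U \<inter> S \<times> S) \<union> (if (s, s) \<in> U then space (\<alpha> \<Otimes>\<^sub>M \<beta>) - S \<times> S else {})"
      by (auto simp: g_def space_pair_measure borel_probD assms split: if_splits)
    also have "\<dots> \<in> sets (\<alpha> \<Otimes>\<^sub>M \<beta>)"
      using * by auto
    finally show "g -` U \<inter> space (\<alpha> \<Otimes>\<^sub>M \<beta>) \<in> sets (\<alpha> \<Otimes>\<^sub>M \<beta>)" .
  qed
  have ae: "AE p in \<alpha> \<Otimes>\<^sub>M \<beta>. g p = p"
  proof -
    have "AE p in \<alpha> \<Otimes>\<^sub>M \<beta>. fst p \<in> S"
    proof (rule AB.AE_pair_measure)
      show "{p \<in> space (\<alpha> \<Otimes>\<^sub>M \<beta>). fst p \<in> S} \<in> sets (\<alpha> \<Otimes>\<^sub>M \<beta>)" by measurable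
      show "AE x in \<alpha>. AE y in \<beta>. fst (x, y) \<in> S" using assms(4) by simp
    qed
    moreover have "AE p in \<alpha> \<Otimes>\<^sub>M \<beta>. snd p \<in> S"
    proof (rule AB.AE_pair_measure)
      show "{p \<in> space (\<alpha> \<Otimes>\<^sub>M \<beta>). snd p \<in> S} \<in> sets (\<alpha> \<Otimes>\<^sub>M \<beta>)" by measurable
      show "AE x in \<alpha>. AE y in \<beta>. snd (x, y) \<in> S" using assms(5) by simp
    qed
    ultimately show ?thesis by eventually_elim (auto simp: g_def mem_Times_iff)
  qed
  have "distr (\<alpha> \<Otimes>\<^sub>M \<beta>) borel g \<in> plans \<alpha> \<beta>"
  proof (rule plansI[OF assms(1,2)])
    fix A :: "'a set" assume [measurable]: "A \<in> sets borel"
    have "(\<integral>\<^sup>+p. indicator A (fst p) \<partial>distr (\<alpha> \<Otimes>\<^sub>M \<beta>) borel g)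
        = (\<integral>\<^sup>+p. indicator A (fst (g p)) \<partial>(\<alpha> \<Otimes>\<^sub>M \<beta>))"
      using g by (subst nn_integral_distr) auto
    also have "\<dots> = (\<integral>\<^sup>+p. indicator A (fst p) \<partial>(\<alpha> \<Otimes>\<^sub>M \<beta>))"
      using ae by (intro nn_integral_cong_AE) auto
    also have "\<dots> = emeasure \<alpha> A"
      by (subst B.nn_integral_fst[symmetric]) (auto simp: B.emeasure_space_1)
    finally show "(\<integral>\<^sup>+p. indicator A (fst p) \<partial>distr (\<alpha> \<Otimes>\<^sub>M \<beta>) borel g) = emeasure \<alpha> A" .
    have "(\<integral>\<^sup>+p. indicator A (snd p) \<partial>distr (\<alpha> \<Otimes>\<^sub>M \<beta>) borel g)
        = (\<integral>\<^sup>+p. indicator A (snd (g p)) \<partial>(\<alpha> \<Otimes>\<^sub>M \<beta>))"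
      using g by (subst nn_integral_distr) auto
    also have "\<dots> = (\<integral>\<^sup>+p. indicator A (snd p) \<partial>(\<alpha> \<Otimes>\<^sub>M \<beta>))"
      using ae by (intro nn_integral_cong_AE) auto
    also have "\<dots> = emeasure \<beta> A"
      by (subst B.nn_integral_fst[symmetric]) (auto simp: A.emeasure_space_1)
    finally show "(\<integral>\<^sup>+p. indicator A (snd p) \<partial>distr (\<alpha> \<Otimes>\<^sub>M \<beta>) borel g) = emeasure \<beta> A" .
  qed auto
  then show ?thesis by blast
qed

section \<open>Cost functions\<close>

locale cost_function =
  fixes h :: "real \<Rightarrow> real"
  assumes mono_h: "mono_on {0..} h" and cont_h: "continuous_on {0..} h"
    and h_0: "h 0 = 0" and h_pos: "\<forall>t>0. 0 < h t"
begin

lemma h_mono: "0 \<le> a \<Longrightarrow> a \<le> b \<Longrightarrow> h a \<le> h b"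
  using mono_h by (auto simp: mono_on_def)

lemma h_nonneg: "0 \<le> a \<Longrightarrow> 0 \<le> h a"
  using h_mono[of 0 a] h_0 by simp

lemma h_less_imp_less: "0 \<le> b \<Longrightarrow> h a < h b \<Longrightarrow> a < b"
  using h_mono[of b a] by (auto simp: not_less[symmetric])

lemma continuous_on_h: "continuous_on A g \<Longrightarrow> (\<And>x. x \<in> A \<Longrightarrow> 0 \<le> g x) \<Longrightarrow> continuous_on A (\<lambda>x. h (g x))"
  by (rule continuous_on_compose2[OF cont_h]) auto

lemma tendsto_h:
  assumes "(g \<longlongrightarrow> a) F" "\<forall>\<^sub>F x in F. 0 \<le> g x" "0 \<le> a"
  shows "((\<lambda>x. h (g x)) \<longlongrightarrow> h a) F"
  by (rule continuous_on_tendsto_compose[OF cont_h assms(1)]) (use assms in auto)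

lemma h_small: "0 < e \<Longrightarrow> \<exists>d>0. h d < e"
proof -
  assume e: "0 < e"
  have "((\<lambda>x. h x) \<longlongrightarrow> h 0) (at_right 0)"
    by (rule tendsto_h) (auto intro: tendsto_ident_at simp: eventually_at_right_less eventually_at_filter)
  then have "\<forall>\<^sub>F x in at_right 0. h x < e"
    using e h_0 by (auto simp: order_tendsto_iff)
  then show ?thesis
    by (auto simp: eventually_at_right_field intro: dense)
      (metis dense)
qed

lemma continuous_on_h_dist: "continuous_on A (\<lambda>(u, v). h (dist u v))"
  by (auto simp: split_beta intro!: continuous_on_h continuous_intros)

lemma continuous_on_h_dist': "continuous_on A (\<lambda>u. h (dist u y))"
  by (auto intro!: continuous_on_h continuous_intros)

lemma measurable_h_dist [measurable]:
  "(\<lambda>p. h (dist (fst p) (snd p))) \<in> borel_measurable (borel :: ('a::metric_space \<times> 'a) measure)"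
  using continuous_on_h_dist[of UNIV]
  by (intro borel_measurable_continuous_onI) (simp add: split_beta)

lemma measurable_h_dist' [measurable]:
  "(\<lambda>u. h (dist u y)) \<in> borel_measurable (borel :: 'a::metric_space measure)"
  by (intro borel_measurable_continuous_onI continuous_on_h_dist')

end

section \<open>Cyclic rearrangement of an optimal plan\<close>

text \<open>
  Cyclical monotonicity, with sets of positive mass in place of points of the support.  Remove from
  \<open>\<gamma>\<close> the mass \<open>\<epsilon>\<close> spread over each \<open>A i\<close>, and couple the sources of \<open>A i\<close> with the targets of the
  next set instead.  The marginals do not change, at least \<open>\<epsilon> * a i\<close> is saved and at most \<open>\<epsilon> * b i\<close> is
  paid for each \<open>i\<close>; optimality compares the two totals.
\<close>

lemma (in cost_function) optimal_plan_cyclic: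
  fixes \<mu> \<nu> :: "'a::metric_space measure" and A :: "nat \<Rightarrow> ('a \<times> 'a) set" and a b :: "nat \<Rightarrow> real" and N :: nat
  defines "\<sigma> \<equiv> \<lambda>i. if i = N then 0 else Suc i"
  assumes opt: "optimal_plan h \<mu> \<nu> \<gamma>" and fin: "transport_cost h \<gamma> < \<infinity>"
    and S: "S \<in> sets borel" "AE x in \<mu>. x \<in> S" "AE x in \<nu>. x \<in> S"
    and D: "countable D" "S \<subseteq> closure D"
    and A: "\<And>i. i \<le> N \<Longrightarrow> A i \<in> sets borel" "\<And>i. i \<le> N \<Longrightarrow> 0 < measure \<gamma> (A i)"
    and AUV: "\<And>i. i \<le> N \<Longrightarrow> A i \<subseteq> U i \<times> V i"
    and U: "\<And>i. i \<le> N \<Longrightarrow> U i \<in> sets borel" and V: "\<And>i. i \<le> N \<Longrightarrow> V i \<in> sets borel"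
    and a: "\<And>i. 0 \<le> a i" "\<And>i u v. i \<le> N \<Longrightarrow> (u, v) \<in> A i \<Longrightarrow> a i \<le> h (dist u v)"
    and b: "\<And>i. 0 \<le> b i"
      "\<And>i u v. i \<le> N \<Longrightarrow> u \<in> U i \<Longrightarrow> v \<in> V (\<sigma> i) \<Longrightarrow> h (dist u v) \<le> b i"
  shows "(\<Sum>i\<le>N. a i) \<le> (\<Sum>i\<le>N. b i)"
proof -
  have \<gamma>: "\<gamma> \<in> plans \<mu> \<nu>" using opt by (simp add: optimal_plan_def)
  note g = plansD[OF \<gamma>]
  interpret \<gamma>: prob_space \<gamma> using g(1) by (rule borel_probD)
  note [measurable_cong] = borel_probD(2)[OF g(1)]
  have sp: "space \<gamma> = UNIV" using g(1) by (rule borel_probD)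
  have sets: "sets \<gamma> = sets borel" using g(1) by (rule borel_probD)
  have \<sigma>: "\<sigma> i \<le> N" if "i \<le> N" for i using that by (auto simp: \<sigma>_def)
  have bij: "bij_betw \<sigma> {..N} {..N}"
  proof -
    have "inj_on \<sigma> {..N}" by (auto simp: inj_on_def \<sigma>_def split: if_splits)
    moreover have "\<sigma> ` {..N} \<subseteq> {..N}" using \<sigma> by auto
    ultimately show ?thesis
      by (simp add: bij_betw_def endo_inj_surj)
  qed
  (* Dividing by the number of sets leaves a nonnegative density even where all of them overlap. *)
  define \<epsilon> where "\<epsilon> = Min ((\<lambda>i. measure \<gamma> (A i)) ` {..N}) / real (Suc N)"
  define c where "c i = \<epsilon> / measure \<gamma> (A i)" for i
  have \<epsilon>_pos: "0 < \<epsilon>" unfolding \<epsilon>_def using A(2) by (auto intro!: divide_pos_pos)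
  have \<epsilon>_le: "\<epsilon> \<le> measure \<gamma> (A i) / real (Suc N)" if "i \<le> N" for i
    unfolding \<epsilon>_def using that by (intro divide_right_mono Min_le) auto
  have c: "0 \<le> c i" "c i \<le> 1 / real (Suc N)" if "i \<le> N" for i
    using \<epsilon>_le[OF that] A(2)[OF that] \<epsilon>_pos by (auto simp: c_def field_simps)
  have \<epsilon>1: "\<epsilon> \<le> 1"
  proof -
    have "measure \<gamma> (A 0) / real (Suc N) \<le> 1 / 1"
      using \<gamma>.prob_le_1[of "A 0"] by (intro frac_le) auto
    then show ?thesis using \<epsilon>_le[of 0] by linarith
  qed
  define k where "k p = (\<Sum>i\<le>N. c i * indicator (A i) p)" for p
  have k: "0 \<le> k p" "k p \<le> 1" for p
  proof -
    show "0 \<le> k p" unfolding k_def using c by (intro sum_nonneg) auto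
    have "k p \<le> (\<Sum>i\<le>N. 1 / real (Suc N))"
      unfolding k_def using c by (intro sum_mono) (auto split: split_indicator)
    then show "k p \<le> 1" by simp
  qed
  have km[measurable]: "k \<in> borel_measurable borel"
    unfolding k_def using A(1) by (intro borel_measurable_sum borel_measurable_times) auto
  define L where "L i = uniform_measure \<gamma> (A i)" for i
  have L: "borel_prob (L i)" if "i \<le> N" for i
    unfolding L_def borel_prob_def using A[OF that] sets
    by (auto intro!: prob_space_uniform_measure simp: \<gamma>.emeasure_eq_measure)
  have L_int: "ennreal \<epsilon> * (\<integral>\<^sup>+p. f p \<partial>L i) = (\<integral>\<^sup>+p. ennreal (c i * indicator (A i) p) * f p \<partial>\<gamma>)"
    if i: "i \<le> N" and f: "f \<in> borel_measurable borel" for i and f :: "'a \<times> 'a \<Rightarrow> ennreal"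
  proof -
    note [measurable] = f A(1)[OF i]
    have "(\<integral>\<^sup>+p. f p \<partial>L i) = (\<integral>\<^sup>+p. f p * indicator (A i) p \<partial>\<gamma>) / emeasure \<gamma> (A i)"
      unfolding L_def by (rule nn_integral_uniform_measure) auto
    also have "ennreal \<epsilon> * \<dots> = ennreal (c i) * (\<integral>\<^sup>+p. f p * indicator (A i) p \<partial>\<gamma>)"
    proof -
      have "ennreal (c i) = ennreal \<epsilon> * inverse (emeasure \<gamma> (A i))"
        using A(2)[OF i] \<epsilon>_pos
        by (simp add: \<gamma>.emeasure_eq_measure c_def inverse_ennreal ennreal_mult[symmetric] divide_inverse)
      then show ?thesis by (simp add: divide_ennreal_def mult_ac)
    qed
    also have "\<dots> = (\<integral>\<^sup>+p. ennreal (c i) * (f p * indicator (A i) p) \<partial>\<gamma>)"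
      by (rule nn_integral_cmult[symmetric]) auto
    also have "\<dots> = (\<integral>\<^sup>+p. ennreal (c i * indicator (A i) p) * f p \<partial>\<gamma>)"
      by (intro nn_integral_cong) (auto split: split_indicator)
    finally show ?thesis .
  qed
  have L_AE: "AE p in L i. fst p \<in> U i \<inter> S" "AE p in L i. snd p \<in> V i \<inter> S" "AE p in L i. p \<in> A i"
    if i: "i \<le> N" for i
  proof -
    have "AE p in \<gamma>. p \<in> A i \<longrightarrow> fst p \<in> U i \<inter> S"
      using plans_AE_fst[OF \<gamma> S(1,2)] AUV[OF i] by (auto elim!: eventually_mono)
    moreover have "AE p in \<gamma>. p \<in> A i \<longrightarrow> snd p \<in> V i \<inter> S"
      using plans_AE_snd[OF \<gamma> S(1,3)] AUV[OF i] by (auto elim!: eventually_mono)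
    ultimately show "AE p in L i. fst p \<in> U i \<inter> S" "AE p in L i. snd p \<in> V i \<inter> S" "AE p in L i. p \<in> A i"
      unfolding L_def using A(1)[OF i] sets by (auto intro!: AE_uniform_measureI)
  qed
  have "\<exists>\<pi>. \<pi> \<in> plans (distr (L i) borel fst) (distr (L (\<sigma> i)) borel snd)" if i: "i \<le> N" for i
  proof (rule ex_coupling[OF _ _ S(1) _ _ D])
    have 1: "fst \<in> L i \<rightarrow>\<^sub>M borel" and 2: "snd \<in> L (\<sigma> i) \<rightarrow>\<^sub>M borel"
      by (simp_all add: L_def measurable_cong_sets[OF borel_probD(2)[OF L] refl]
          measurable_cong_sets[OF sets refl] borel_measurable_fst_snd)
    show "borel_prob (distr (L i) borel fst)" "borel_prob (distr (L (\<sigma> i)) borel snd)"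
      using i \<sigma>[OF i] by (auto intro!: borel_prob_distr L borel_measurable_fst_snd)
    show "AE x in distr (L i) borel fst. x \<in> S"
      using L_AE(1)[OF i] S(1) by (subst AE_distr_iff[OF 1]) auto
    show "AE x in distr (L (\<sigma> i)) borel snd. x \<in> S"
      using L_AE(2)[OF \<sigma>[OF i]] S(1) by (subst AE_distr_iff[OF 2]) auto
  qed
  then obtain \<pi> where \<pi>: "\<And>i. i \<le> N \<Longrightarrow> \<pi> i \<in> plans (distr (L i) borel fst) (distr (L (\<sigma> i)) borel snd)"
    by metis
  note \<pi>b = plansD(1)[OF \<pi>]
  (* The last index carries what remains of \<open>\<gamma>\<close>, the others the new couplings. *)
  define M where "M i = (if i \<le> N then scale_measure (ennreal \<epsilon>) (\<pi> i) else density \<gamma> (\<lambda>p. ennreal (1 - k p)))" for i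
  have M_sets: "sets (M i) = sets borel" for i
    using borel_probD(2)[OF \<pi>b, of i] by (auto simp: M_def sets)
  have M_sp: "space (M i) = UNIV" for i
    using sets_eq_imp_space_eq[OF M_sets, of i] by simp
  have M_sub: "subprob_space (M i)" for i
  proof (rule subprob_spaceI)
    show "emeasure (M i) (space (M i)) \<le> 1"
    proof (cases "i \<le> N")
      case True
      interpret P: prob_space "\<pi> i" using \<pi>b[OF True] by (rule borel_probD)
      have "emeasure (\<pi> i) UNIV = 1"
        using P.emeasure_space_1 borel_probD(3)[OF \<pi>b[OF True]] by simp
      then show ?thesis using True \<epsilon>1 by (simp add: M_sp) (simp add: M_def)
    next
      case False
      have "(\<integral>\<^sup>+p. ennreal (1 - k p) \<partial>\<gamma>) \<le> (\<integral>\<^sup>+p. 1 \<partial>\<gamma>)"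
        using k by (intro nn_integral_mono) auto
      then show ?thesis
        using False by (simp add: M_sp) (simp add: M_def emeasure_density sp \<gamma>.emeasure_space_1[unfolded sp])
    qed
    show "space (M i) \<noteq> {}" by (simp add: M_sp)
  qed
  obtain K where K: "sets K = sets borel"
    "\<And>f. f \<in> borel_measurable borel \<Longrightarrow> (\<integral>\<^sup>+x. f x \<partial>K) = (\<Sum>i\<le>Suc N. \<integral>\<^sup>+x. f x \<partial>M i)"
    using ex_measure_sum[of "{..Suc N}" M] M_sub M_sets by auto
  have key: "(\<integral>\<^sup>+p. f p \<partial>K) + (\<Sum>i\<le>N. ennreal \<epsilon> * (\<integral>\<^sup>+p. f p \<partial>L i))
      = (\<integral>\<^sup>+p. f p \<partial>\<gamma>) + (\<Sum>i\<le>N. ennreal \<epsilon> * (\<integral>\<^sup>+p. f p \<partial>\<pi> i))"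
    if f[measurable]: "f \<in> borel_measurable borel" for f
  proof -
    have 1: "(\<integral>\<^sup>+p. f p \<partial>M i) = ennreal \<epsilon> * (\<integral>\<^sup>+p. f p \<partial>\<pi> i)" if i: "i \<le> N" for i
    proof -
      have "f \<in> borel_measurable (\<pi> i)"
        by (simp add: f measurable_cong_sets[OF borel_probD(2)[OF \<pi>b[OF i]] refl])
      then show ?thesis using i by (simp add: M_def nn_integral_scale_measure)
    qed
    have 2: "(\<integral>\<^sup>+p. f p \<partial>M (Suc N)) = (\<integral>\<^sup>+p. ennreal (1 - k p) * f p \<partial>\<gamma>)"
      by (simp add: M_def nn_integral_density)
    have 3: "(\<Sum>i\<le>N. ennreal \<epsilon> * (\<integral>\<^sup>+p. f p \<partial>L i)) = (\<integral>\<^sup>+p. ennreal (k p) * f p \<partial>\<gamma>)"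
    proof -
      have "(\<Sum>i\<le>N. ennreal \<epsilon> * (\<integral>\<^sup>+p. f p \<partial>L i))
          = (\<Sum>i\<le>N. (\<integral>\<^sup>+p. ennreal (c i * indicator (A i) p) * f p \<partial>\<gamma>))"
        by (intro sum.cong refl L_int) auto
      also have "\<dots> = (\<integral>\<^sup>+p. (\<Sum>i\<le>N. ennreal (c i * indicator (A i) p) * f p) \<partial>\<gamma>)"
        using A(1) by (intro nn_integral_sum[symmetric]) auto
      also have "\<dots> = (\<integral>\<^sup>+p. ennreal (k p) * f p \<partial>\<gamma>)"
      proof (intro nn_integral_cong)
        fix p
        have "(\<Sum>i\<le>N. ennreal (c i * indicator (A i) p)) = ennreal (k p)"
          unfolding k_def using c by (intro sum_ennreal) auto
        then show "(\<Sum>i\<le>N. ennreal (c i * indicator (A i) p) * f p) = ennreal (k p) * f p"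
          by (simp only: sum_distrib_right[symmetric])
      qed
      finally show ?thesis .
    qed
    have "(\<integral>\<^sup>+p. ennreal (1 - k p) * f p \<partial>\<gamma>) + (\<integral>\<^sup>+p. ennreal (k p) * f p \<partial>\<gamma>)
        = (\<integral>\<^sup>+p. ennreal (1 - k p) * f p + ennreal (k p) * f p \<partial>\<gamma>)"
      by (intro nn_integral_add[symmetric]) auto
    also have "\<dots> = (\<integral>\<^sup>+p. f p \<partial>\<gamma>)"
    proof (intro nn_integral_cong)
      fix p
      have "ennreal (1 - k p) * f p + ennreal (k p) * f p = ennreal (1 - k p + k p) * f p"
        using k[of p] by (subst ennreal_plus) (auto simp: distrib_right)
      then show "ennreal (1 - k p) * f p + ennreal (k p) * f p = f p" by simp
    qed
    finally show ?thesis
      unfolding K(2)[OF f] 3 by (simp add: 1 2 algebra_simps)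
  qed
  have fin1: "ennreal \<epsilon> * (\<integral>\<^sup>+p. indicator B (f p) \<partial>L i) \<noteq> \<infinity>"
    if "i \<le> N" for i B and f :: "'a \<times> 'a \<Rightarrow> 'a"
  proof -
    interpret P: prob_space "L i" using L[OF that] by (rule borel_probD)
    have "(\<integral>\<^sup>+p. indicator B (f p) \<partial>L i) \<le> (\<integral>\<^sup>+p. 1 \<partial>L i)"
      by (intro nn_integral_mono) (auto split: split_indicator)
    also have "\<dots> = 1" by (simp add: P.emeasure_space_1)
    finally show ?thesis by (auto simp: ennreal_mult_eq_top_iff top_unique)
  qed
  have cancel: "v = w" if "v + (\<Sum>i\<le>N. x i) = w + (\<Sum>i\<le>N. y i)"
    "(\<Sum>i\<le>N. y i) = (\<Sum>i\<le>N. x i)" "\<And>i. i \<le> N \<Longrightarrow> x i \<noteq> \<infinity>" for v w :: ennreal and x y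
  proof -
    define X where "X = (\<Sum>i\<le>N. x i)"
    have X: "X \<noteq> \<infinity>" unfolding X_def using that(3) by (simp add: ennreal_sum_eq_top)
    have "X + v = X + w" using that(1) unfolding that(2) X_def by (simp only: add.commute)
    then show ?thesis using X by (simp only: ennreal_add_left_cancel simp_thms)
  qed
  have marg: "(\<integral>\<^sup>+p. indicator B (f p) \<partial>M) = emeasure (distr M borel f) B"
    if "borel_prob M" "f \<in> borel \<rightarrow>\<^sub>M borel" "B \<in> sets borel" for M :: "('a \<times> 'a) measure" and f and B :: "'a set"
  proof -
    have "f \<in> M \<rightarrow>\<^sub>M borel"
      by (simp add: that(2) measurable_cong_sets[OF borel_probD(2)[OF that(1)] refl])
    then show ?thesis
      using nn_integral_distr[of f M borel "indicator B"] that(3) by simp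
  qed
  have K_plan: "K \<in> plans \<mu> \<nu>"
  proof (rule plansI[OF g(2,3) K(1)])
    fix B :: "'a set" assume B[measurable]: "B \<in> sets borel"
    have m: "(\<lambda>p. indicator B (fst p)) \<in> borel_measurable (borel :: ('a \<times> 'a) measure)"
      "(\<lambda>p. indicator B (snd p)) \<in> borel_measurable (borel :: ('a \<times> 'a) measure)" by measurable
    note mg = marg[OF _ _ B]
    have *: "(\<Sum>i\<le>N. ennreal \<epsilon> * (\<integral>\<^sup>+p. indicator B (fst p) \<partial>\<pi> i))
        = (\<Sum>i\<le>N. ennreal \<epsilon> * (\<integral>\<^sup>+p. indicator B (fst p) \<partial>L i))"
      using plansD(4)[OF \<pi>] by (intro sum.cong refl) (simp add: mg \<pi>b L borel_measurable_fst_snd)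
    have "(\<integral>\<^sup>+p. indicator B (fst p) \<partial>K) = (\<integral>\<^sup>+p. indicator B (fst p) \<partial>\<gamma>)"
      by (rule cancel[OF key[OF m(1)] * fin1])
    then show "(\<integral>\<^sup>+p. indicator B (fst p) \<partial>K) = emeasure \<mu> B"
      using g(4) by (simp add: mg g(1) borel_measurable_fst_snd)
    have "(\<Sum>i\<le>N. ennreal \<epsilon> * (\<integral>\<^sup>+p. indicator B (snd p) \<partial>\<pi> i))
        = (\<Sum>i\<le>N. ennreal \<epsilon> * (\<integral>\<^sup>+p. indicator B (snd p) \<partial>L (\<sigma> i)))"
      using plansD(5)[OF \<pi>] \<sigma> by (intro sum.cong refl) (simp add: mg \<pi>b L borel_measurable_fst_snd)
    also have "\<dots> = (\<Sum>i\<le>N. ennreal \<epsilon> * (\<integral>\<^sup>+p. indicator B (snd p) \<partial>L i))"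
      by (rule sum.reindex_bij_betw[OF bij])
    finally have *: "(\<Sum>i\<le>N. ennreal \<epsilon> * (\<integral>\<^sup>+p. indicator B (snd p) \<partial>\<pi> i))
        = (\<Sum>i\<le>N. ennreal \<epsilon> * (\<integral>\<^sup>+p. indicator B (snd p) \<partial>L i))" .
    have "(\<integral>\<^sup>+p. indicator B (snd p) \<partial>K) = (\<integral>\<^sup>+p. indicator B (snd p) \<partial>\<gamma>)"
      by (rule cancel[OF key[OF m(2)] * fin1])
    then show "(\<integral>\<^sup>+p. indicator B (snd p) \<partial>K) = emeasure \<nu> B"
      using g(5) by (simp add: mg g(1) borel_measurable_fst_snd)
  qed
  define C where "C p = ennreal (h (dist (fst p) (snd p)))" for p :: "'a \<times> 'a"
  have C[measurable]: "C \<in> borel_measurable borel" unfolding C_def by measurable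
  have cost: "transport_cost h G = (\<integral>\<^sup>+p. C p \<partial>G)" for G
    unfolding transport_cost_def C_def by (intro nn_integral_cong) auto
  have la: "ennreal (a i) \<le> (\<integral>\<^sup>+p. C p \<partial>L i)" if i: "i \<le> N" for i
  proof -
    interpret P: prob_space "L i" using L[OF i] by (rule borel_probD)
    have "(\<integral>\<^sup>+p. ennreal (a i) \<partial>L i) \<le> (\<integral>\<^sup>+p. C p \<partial>L i)"
      using L_AE(3)[OF i] by (intro nn_integral_mono_AE) (auto elim!: eventually_mono simp: C_def intro!: ennreal_leI a(2)[OF i])
    then show ?thesis by (simp add: P.emeasure_space_1)
  qed
  have lb: "(\<integral>\<^sup>+p. C p \<partial>\<pi> i) \<le> ennreal (b i)" if i: "i \<le> N" for i
  proof -
    interpret P: prob_space "\<pi> i" using \<pi>b[OF i] by (rule borel_probD)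
    have 1: "fst \<in> L i \<rightarrow>\<^sub>M borel" and 2: "snd \<in> L (\<sigma> i) \<rightarrow>\<^sub>M borel"
      by (simp_all add: L_def measurable_cong_sets[OF sets refl] borel_measurable_fst_snd)
    have "AE x in distr (L i) borel fst. x \<in> U i"
      using L_AE(1)[OF i] U[OF i] by (subst AE_distr_iff[OF 1]) auto
    then have 3: "AE p in \<pi> i. fst p \<in> U i" by (rule plans_AE_fst[OF \<pi>[OF i] U[OF i]])
    have "AE x in distr (L (\<sigma> i)) borel snd. x \<in> V (\<sigma> i)"
      using L_AE(2)[OF \<sigma>[OF i]] V[OF \<sigma>[OF i]] by (subst AE_distr_iff[OF 2]) auto
    then have 4: "AE p in \<pi> i. snd p \<in> V (\<sigma> i)" by (rule plans_AE_snd[OF \<pi>[OF i] V[OF \<sigma>[OF i]]])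
    have "AE p in \<pi> i. C p \<le> ennreal (b i)"
      using 3 4 by eventually_elim (auto simp: C_def intro!: ennreal_leI b(2)[OF i])
    then have "(\<integral>\<^sup>+p. C p \<partial>\<pi> i) \<le> (\<integral>\<^sup>+p. ennreal (b i) \<partial>\<pi> i)"
      by (intro nn_integral_mono_AE)
    then show ?thesis by (simp add: P.emeasure_space_1)
  qed
  have sm: "(\<Sum>i\<le>N. ennreal \<epsilon> * ennreal (x i)) = ennreal (\<epsilon> * (\<Sum>i\<le>N. x i))"
    if "\<And>i. 0 \<le> x i" for x :: "nat \<Rightarrow> real"
  proof -
    have "(\<Sum>i\<le>N. ennreal (x i)) = ennreal (\<Sum>i\<le>N. x i)" using that by (intro sum_ennreal)
    then show ?thesis
      using that \<epsilon>_pos by (simp only: sum_distrib_left[symmetric]) (auto intro!: ennreal_mult[symmetric] sum_nonneg)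
  qed
  have "transport_cost h \<gamma> + ennreal (\<epsilon> * (\<Sum>i\<le>N. a i)) \<le> transport_cost h K + ennreal (\<epsilon> * (\<Sum>i\<le>N. a i))"
    using opt K_plan by (intro add_right_mono) (auto simp: optimal_plan_def)
  also have "\<dots> \<le> transport_cost h K + (\<Sum>i\<le>N. ennreal \<epsilon> * (\<integral>\<^sup>+p. C p \<partial>L i))"
    unfolding sm[of a, OF a(1), symmetric] using la by (intro add_left_mono sum_mono mult_left_mono) auto
  also have "\<dots> = transport_cost h \<gamma> + (\<Sum>i\<le>N. ennreal \<epsilon> * (\<integral>\<^sup>+p. C p \<partial>\<pi> i))"
    unfolding cost by (rule key) (rule C)
  also have "\<dots> \<le> transport_cost h \<gamma> + ennreal (\<epsilon> * (\<Sum>i\<le>N. b i))"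
    unfolding sm[of b, OF b(1), symmetric] using lb by (intro add_left_mono sum_mono mult_left_mono) auto
  finally have "ennreal (\<epsilon> * (\<Sum>i\<le>N. a i)) \<le> ennreal (\<epsilon> * (\<Sum>i\<le>N. b i))"
    using fin by (auto simp: ennreal_add_left_cancel_le)
  then show ?thesis
    using \<epsilon>_pos b(1) by (subst (asm) ennreal_le_iff) (auto intro!: sum_nonneg mult_nonneg_nonneg)
qed

section \<open>The estimate for a support with slack in its chains\<close>

lemma min_ball_mass_bdd: "bdd_below ((\<lambda>x. measure \<mu> (ball x t)) ` supp \<mu>)"
  by (auto intro!: bdd_belowI[of _ 0])

lemma min_ball_mass_le: "x \<in> supp \<mu> \<Longrightarrow> min_ball_mass \<mu> t \<le> measure \<mu> (ball x t)"
  unfolding min_ball_mass_def by (rule cINF_lower[OF min_ball_mass_bdd])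

lemma supp_nonempty: "emeasure \<mu> (supp \<mu>) = 1 \<Longrightarrow> supp \<mu> \<noteq> {}"
  by auto

text \<open>
  Finitely many balls of half the radius, centred in the support, cover it, and every ball of the
  full radius contains one of them.
\<close>

lemma min_ball_mass_pos:
  assumes "borel_prob \<mu>" "compact (supp \<mu>)" "supp \<mu> \<noteq> {}" "0 < t"
  shows "0 < min_ball_mass \<mu> t"
proof -
  interpret prob_space \<mu> using assms(1) by (rule borel_probD)
  obtain F where F: "F \<subseteq> supp \<mu>" "finite F" "supp \<mu> \<subseteq> (\<Union>x\<in>F. ball x (t/2))"
    using compactE_image[OF assms(2), of "supp \<mu>" "\<lambda>x. ball x (t/2)"] assms(4) by force
  have "F \<noteq> {}" using F assms(3) by auto
  define m where "m = Min ((\<lambda>x. measure \<mu> (ball x (t/2))) ` F)"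
  have "0 < m"
    unfolding m_def using F \<open>F \<noteq> {}\<close> assms(4) by (auto simp: supp_def)
  also have "m \<le> min_ball_mass \<mu> t"
    unfolding min_ball_mass_def
  proof (rule cINF_greatest[OF assms(3)])
    fix x assume "x \<in> supp \<mu>"
    then obtain y where y: "y \<in> F" "dist y x < t/2" using F by auto
    have "m \<le> measure \<mu> (ball y (t/2))" unfolding m_def using F y by (intro Min_le) auto
    also have "ball y (t/2) \<subseteq> ball x t"
    proof
      fix z assume "z \<in> ball y (t/2)"
      then show "z \<in> ball x t" using y dist_triangle[of x z y] by (simp add: dist_commute)
    qed
    then have "measure \<mu> (ball y (t/2)) \<le> measure \<mu> (ball x t)"
      by (intro finite_measure_mono) (auto simp: borel_probD(2)[OF assms(1)])
    finally show "m \<le> measure \<mu> (ball x t)" .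
  qed
  finally show ?thesis .
qed

lemma min_ball_mass_mono:
  assumes "borel_prob \<mu>" "supp \<mu> \<noteq> {}" "s \<le> t"
  shows "min_ball_mass \<mu> s \<le> min_ball_mass \<mu> t"
proof -
  interpret prob_space \<mu> using assms(1) by (rule borel_probD)
  show ?thesis
    unfolding min_ball_mass_def using assms(2,3)
    by (intro cINF_mono[OF _ min_ball_mass_bdd])
      (auto intro!: finite_measure_mono bexI simp: borel_probD(2)[OF assms(1)])
qed

lemma min_ball_mass_nonneg: "supp \<mu> \<noteq> {} \<Longrightarrow> 0 \<le> min_ball_mass \<mu> t"
  unfolding min_ball_mass_def by (rule cINF_greatest) auto

text \<open>
  Otherwise finitely many null balls would cover the compact set.
\<close>

lemma ex_supp_of_compact:
  fixes K :: "'a::metric_space set"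
  assumes "borel_prob \<gamma>" "compact K" "0 < measure \<gamma> K"
  shows "\<exists>p\<in>K. p \<in> supp \<gamma>"
proof (rule ccontr)
  interpret prob_space \<gamma> using assms(1) by (rule borel_probD)
  assume "\<not> (\<exists>p\<in>K. p \<in> supp \<gamma>)"
  then have "\<forall>p\<in>K. \<exists>r>0. measure \<gamma> (ball p r) = 0"
    by (auto simp: supp_def zero_less_measure_iff)
  then obtain r where r: "\<And>p. p \<in> K \<Longrightarrow> 0 < r p" "\<And>p. p \<in> K \<Longrightarrow> measure \<gamma> (ball p (r p)) = 0"
    by metis
  obtain F where F: "F \<subseteq> K" "finite F" "K \<subseteq> (\<Union>x\<in>F. ball x (r x))"
    using compactE_image[OF assms(2), of K "\<lambda>x. ball x (r x)"] r(1) by force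
  have "measure \<gamma> K \<le> measure \<gamma> (\<Union>x\<in>F. ball x (r x))"
    using F by (intro finite_measure_mono) (auto simp: borel_probD(2)[OF assms(1)])
  also have "\<dots> \<le> (\<Sum>x\<in>F. measure \<gamma> (ball x (r x)))"
    using F by (intro finite_measure_subadditive_finite) (auto simp: borel_probD(2)[OF assms(1)])
  also have "\<dots> = 0" using F r by (intro sum.neutral) auto
  finally show False using assms(3) by simp
qed

lemma measurable_dist_pair:
  "(\<lambda>(x, y). ennreal (dist x y)) \<in> borel_measurable (borel :: ('a::metric_space \<times> 'a) measure)"
  unfolding split_beta
  by (intro measurable_compose[OF _ measurable_ennreal] borel_measurable_continuous_onI continuous_intros)

text \<open>
  The distance attains its maximum on the part of the support of \<open>\<gamma>\<close> in \<open>S \<times> S\<close>.  Larger distances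
  occur on compact sets without support points, which are null; every neighbourhood of the
  maximal pair has positive mass.
\<close>

lemma ex_extremal_pair:
  fixes \<mu> :: "'a::metric_space measure"
  assumes "\<gamma> \<in> plans \<mu> \<nu>" "compact S" "AE x in \<mu>. x \<in> S" "AE x in \<nu>. x \<in> S"
  shows "\<exists>x\<in>S. \<exists>y\<in>S. (x, y) \<in> supp \<gamma> \<and> ess_dist \<gamma> = ennreal (dist x y)"
proof -
  note g = plansD(1)[OF assms(1)]
  interpret prob_space \<gamma> using g by (rule borel_probD)
  note sets = borel_probD(2)[OF g]
  have Sb: "S \<in> sets borel" using compact_imp_closed[OF assms(2)] by auto
  have ae: "AE p in \<gamma>. p \<in> S \<times> S"
    using plans_AE_fst[OF assms(1) Sb assms(3)] plans_AE_snd[OF assms(1) Sb assms(4)]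
    by eventually_elim (auto simp: mem_Times_iff)
  have cSS: "compact (S \<times> S)" using assms(2) by (intro compact_Times)
  then have SSb: "S \<times> S \<in> sets \<gamma>" using compact_imp_closed[OF cSS] sets by auto
  have 1: "measure \<gamma> (S \<times> S) = 1" using ae SSb by (simp add: AE_in_set_eq_1)
  define K where "K = (S \<times> S) \<inter> supp \<gamma>"
  have "compact K" unfolding K_def using cSS closed_supp[OF g] by (rule compact_Int_closed)
  moreover have "K \<noteq> {}" using ex_supp_of_compact[OF g cSS] 1 by (auto simp: K_def)
  moreover have "continuous_on K (\<lambda>q. dist (fst q) (snd q))" by (intro continuous_intros)
  ultimately obtain p where p: "p \<in> K" "\<And>q. q \<in> K \<Longrightarrow> dist (fst q) (snd q) \<le> dist (fst p) (snd p)"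
    using continuous_attains_sup[of K "\<lambda>q. dist (fst q) (snd q)"] by blast
  define d where "d = dist (fst p) (snd p)"
  have "AE q in \<gamma>. dist (fst q) (snd q) < d + 1 / real (Suc n)" for n
  proof -
    let ?C = "{q. d + 1 / real (Suc n) \<le> dist (fst q) (snd q)}"
    have cl: "closed ?C" by (intro closed_Collect_le continuous_intros)
    have "\<not> 0 < measure \<gamma> (S \<times> S \<inter> ?C)"
    proof
      assume "0 < measure \<gamma> (S \<times> S \<inter> ?C)"
      from ex_supp_of_compact[OF g compact_Int_closed[OF cSS cl] this]
      obtain q where "q \<in> K" "d + 1 / real (Suc n) \<le> dist (fst q) (snd q)"
        by (auto simp: K_def)
      moreover have "0 < 1 / real (Suc n)" by simp
      ultimately show False using p(2)[of q] unfolding d_def by linarith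
    qed
    then have "measure \<gamma> (S \<times> S \<inter> ?C) = 0" by (simp only: zero_less_measure_iff not_not)
    then have "emeasure \<gamma> (S \<times> S \<inter> ?C) = 0" by (simp add: emeasure_eq_measure)
    moreover have "?C \<in> sets \<gamma>" unfolding sets using cl by (rule borel_closed)
    ultimately have "S \<times> S \<inter> ?C \<in> null_sets \<gamma>"
      using SSb by (intro null_setsI sets.Int)
    then have "AE q in \<gamma>. q \<notin> S \<times> S \<inter> ?C" by (rule AE_not_in)
    with ae show ?thesis by eventually_elim auto
  qed
  then have "AE q in \<gamma>. \<forall>n. dist (fst q) (snd q) < d + 1 / real (Suc n)"
    by (simp add: AE_all_countable)
  then have "AE q in \<gamma>. dist (fst q) (snd q) \<le> d"
  proof eventually_elim
    case (elim q)
    show ?case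
    proof (rule ccontr)
      assume "\<not> ?thesis"
      then obtain n where "1 / real (Suc n) < dist (fst q) (snd q) - d"
        using nat_approx_posE[of "dist (fst q) (snd q) - d"] by auto
      then show False using elim[rule_format, of n] by linarith
    qed
  qed
  then have "ess_dist \<gamma> \<le> ennreal d"
    unfolding ess_dist_def using measurable_dist_pair measurable_cong_sets[OF sets refl]
    by (intro esssup_I) (auto simp: split_beta elim!: eventually_mono intro!: ennreal_leI)
  moreover have "ennreal d \<le> ess_dist \<gamma>"
  proof (rule ccontr)
    assume "\<not> ennreal d \<le> ess_dist \<gamma>"
    then have less: "ess_dist \<gamma> < ennreal d" by simp
    then obtain e where e: "ess_dist \<gamma> = ennreal e" "0 \<le> e" by (cases "ess_dist \<gamma>") auto
    let ?U = "{q. e < dist (fst q) (snd q)}"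
    have "open ?U" by (intro open_Collect_less continuous_intros)
    moreover have "p \<in> ?U" using less e by (simp add: d_def ennreal_less_iff)
    ultimately obtain r where r: "0 < r" "ball p r \<subseteq> ?U" by (rule openE)
    have "AE q in \<gamma>. dist (fst q) (snd q) \<le> e"
      using esssup_AE[of "\<lambda>(x, y). ennreal (dist x y)" \<gamma>] e
      by (auto simp: ess_dist_def[symmetric] split_beta elim!: eventually_mono)
    then have "AE q in \<gamma>. q \<notin> ball p r" using r by (auto elim!: eventually_mono)
    then have "measure \<gamma> (ball p r) = 0"
      by (intro measure_eq_0_of_AE[OF g]) auto
    then show False using p(1) r by (auto simp: K_def supp_def)
  qed
  ultimately show ?thesis
    using p(1) by (intro bexI[of _ "fst p"] bexI[of _ "snd p"]) (auto simp: K_def d_def)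
qed

lemma compact_ex_countable_dense:
  fixes S :: "'a::metric_space set"
  assumes "compact S"
  shows "\<exists>D. countable D \<and> S \<subseteq> closure D"
proof -
  have "\<exists>k. finite k \<and> S \<subseteq> (\<Union>x\<in>k. ball x (1 / real (Suc n)))" for n
  proof -
    have "0 < 1 / real (Suc n)" by simp
    then show ?thesis using assms unfolding compact_eq_totally_bounded by blast
  qed
  then obtain k where k: "\<And>n. finite (k n)" "\<And>n. S \<subseteq> (\<Union>x\<in>k n. ball x (1 / real (Suc n)))"
    by metis
  have "S \<subseteq> closure (\<Union>n. k n)"
  proof
    fix x assume x: "x \<in> S"
    show "x \<in> closure (\<Union>n. k n)"
      unfolding closure_approachable
    proof (intro allI impI)
      fix e :: real assume "0 < e"
      then obtain n where n: "1 / real (Suc n) < e" using nat_approx_posE by blast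
      obtain y where "y \<in> k n" "dist y x < 1 / real (Suc n)" using k(2)[of n] x by auto
      then show "\<exists>y\<in>\<Union>n. k n. dist y x < e" using n by (intro bexI[of _ y]) auto
    qed
  qed
  moreover have "countable (\<Union>n. k n)" using k(1) by (auto intro: countable_finite)
  ultimately show ?thesis by blast
qed

text \<open>
  The sets in the cyclic rearrangement are a neighbourhood of the extremal pair, on which the cost
  exceeds the total cost of the chain with slack, and near each inner point of the chain the mass
  moved only a little.
\<close>

lemma (in cost_function) slack_modulus_estimate:
  fixes \<mu> :: "'a::metric_space measure"
  assumes \<mu>: "borel_prob \<mu>" "emeasure \<mu> (supp \<mu>) = 1" and S: "compact (supp \<mu>)"
    and \<rho>: "chain_slack h (supp \<mu>) \<rho>"
  shows "linfty_estimate h \<mu> (slack_modulus h \<mu> \<rho>)"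
  unfolding linfty_estimate_def
proof (intro ballI allI impI)
  fix \<nu> and \<gamma> assume \<nu>: "\<nu> \<in> probs_on (supp \<mu>)" and opt: "optimal_plan h \<mu> \<nu> \<gamma>"
  let ?S = "supp \<mu>"
  have \<gamma>: "\<gamma> \<in> plans \<mu> \<nu>" using opt by (simp add: optimal_plan_def)
  note g = plansD[OF \<gamma>]
  interpret \<gamma>: prob_space \<gamma> using g(1) by (rule borel_probD)
  have sets: "sets \<gamma> = sets borel" using g(1) by (rule borel_probD)
  have Sb: "?S \<in> sets borel" using closed_supp[OF \<mu>(1)] by auto
  have ae\<mu>: "AE x in \<mu>. x \<in> ?S" by (rule AE_in_of_emeasure_1[OF \<mu>(1) Sb \<mu>(2)])
  have ae\<nu>: "AE x in \<nu>. x \<in> ?S"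
    using \<nu> by (intro AE_in_of_emeasure_1[OF _ Sb]) (auto simp: probs_on_def)
  obtain D where D: "countable D" "?S \<subseteq> closure D" using compact_ex_countable_dense[OF S] by auto
  obtain x y where xy: "x \<in> ?S" "y \<in> ?S" "(x, y) \<in> supp \<gamma>" "ess_dist \<gamma> = ennreal (dist x y)"
    using ex_extremal_pair[OF \<gamma> S ae\<mu> ae\<nu>] by blast
  define s where "s = dist x y"
  have eval: "eval_ext \<omega> (ess_dist \<gamma>) = ennreal (\<omega> s)" for \<omega>
    by (simp add: eval_ext_def xy(4) s_def)
  show "eval_ext (slack_modulus h \<mu> \<rho>) (ess_dist \<gamma>) \<le> transport_cost h \<gamma>"
  proof (cases "x = y")
    case True
    then show ?thesis using \<rho> h_0 by (simp add: eval s_def slack_modulus_def chain_slack_def)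
  next
    case False
    then have "0 < s" by (simp add: s_def)
    define r where "r = \<rho> s / 4"
    have r: "0 < r" using \<rho> \<open>0 < s\<close> by (simp add: r_def chain_slack_def)
    have "\<exists>N z. is_chain ?S x y N z \<and> (\<Sum>i=0..N. h (dist (z i) (z (i + 1)) + \<rho> s)) < h s"
      using \<rho> xy(1,2) False unfolding chain_slack_def s_def by blast
    then obtain N z where z: "is_chain ?S x y N z"
      and sum: "(\<Sum>i=0..N. h (dist (z i) (z (i + 1)) + \<rho> s)) < h s" by blast
    (* \<open>\<kappa>\<close> separates the cost of the chain from the cost of the direct move, which nearby pairs exceed. *)
    obtain \<kappa> where \<kappa>: "(\<Sum>i=0..N. h (dist (z i) (z (i + 1)) + \<rho> s)) < \<kappa>" "\<kappa> < h s"
      using dense[OF sum] by blast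
    have \<kappa>0: "0 \<le> \<kappa>"
      using \<kappa>(1) r by (intro order_trans[OF _ less_imp_le[OF \<kappa>(1)]] sum_nonneg h_nonneg) (auto simp: r_def)
    show ?thesis
    proof (rule ccontr)
      assume "\<not> ?thesis"
      then have small: "transport_cost h \<gamma> < ennreal (min_ball_mass \<mu> r * h r)"
        by (simp add: eval slack_modulus_def r_def)
      have near: "0 < measure \<gamma> {p. dist (fst p) w < r \<and> dist (fst p) (snd p) < r}" if w: "w \<in> ?S" for w
      proof -
        let ?F = "{p. r \<le> dist (fst p) (snd p)}" and ?B = "{p. dist (fst p) w < r}"
        have F: "?F \<in> sets \<gamma>" unfolding sets
          by (intro borel_closed closed_Collect_le continuous_intros)
        have B: "?B \<in> sets \<gamma>" unfolding sets
          by (intro borel_open open_Collect_less continuous_intros)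
        have "ennreal (h r * measure \<gamma> ?F) = ennreal (h r) * emeasure \<gamma> ?F"
          using h_nonneg[of r] r by (simp add: \<gamma>.emeasure_eq_measure ennreal_mult')
        also have "\<dots> = (\<integral>\<^sup>+p. ennreal (h r) * indicator ?F p \<partial>\<gamma>)"
          using F by (simp add: nn_integral_cmult_indicator)
        also have "\<dots> \<le> transport_cost h \<gamma>"
          unfolding transport_cost_def using r h_mono
          by (intro nn_integral_mono) (auto split: split_indicator intro!: ennreal_leI)
        also note small
        finally have "h r * measure \<gamma> ?F < min_ball_mass \<mu> r * h r"
          using h_nonneg[of r] r by (subst (asm) ennreal_less_iff) auto
        then have "measure \<gamma> ?F < min_ball_mass \<mu> r"
          using h_pos r by (simp add: mult.commute)
        also have "\<dots> \<le> measure \<mu> (ball w r)" by (rule min_ball_mass_le[OF w])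
        also have "\<dots> = measure (distr \<gamma> borel fst) (ball w r)" by (simp add: g(4))
        also have "\<dots> = measure \<gamma> ?B"
        proof -
          have "fst \<in> \<gamma> \<rightarrow>\<^sub>M borel"
            by (simp add: measurable_cong_sets[OF sets refl] borel_measurable_fst_snd)
          moreover have "fst -` ball w r \<inter> space \<gamma> = ?B"
            by (auto simp: borel_probD(3)[OF g(1)] dist_commute)
          ultimately show ?thesis by (subst measure_distr) auto
        qed
        finally have "measure \<gamma> ?F < measure \<gamma> ?B" .
        moreover have "measure \<gamma> ?B \<le> measure \<gamma> (?B - ?F) + measure \<gamma> ?F"
          using F B \<gamma>.finite_measure_mono[of ?B "(?B - ?F) \<union> ?F"] measure_Un_le[of "?B - ?F" \<gamma> ?F]
          by auto
        moreover have "?B - ?F = {p. dist (fst p) w < r \<and> dist (fst p) (snd p) < r}" by auto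
        ultimately show ?thesis by simp
      qed
      define A where "A i = (if i = 0 then {p. dist (fst p) x < r \<and> dist (snd p) y < r \<and> \<kappa> < h (dist (fst p) (snd p))}
        else {p. dist (fst p) (z i) < r \<and> dist (fst p) (snd p) < r})" for i :: nat
      define U where "U i = ball (z i) r" for i
      define V where "V i = (if i = 0 then ball y r else ball (z i) (2 * r))" for i
      have z0: "z 0 = x" "z (Suc N) = y" "\<And>i. i \<le> Suc N \<Longrightarrow> z i \<in> ?S"
        using z by (auto simp: is_chain_def)
      have op: "open (A i)" for i
        unfolding A_def
        by (auto intro!: open_Collect_conj open_Collect_less continuous_intros continuous_on_h)
      have "(\<Sum>i\<le>N. if i = 0 then \<kappa> else 0) \<le> (\<Sum>i\<le>N. h (dist (z i) (z (i + 1)) + \<rho> s))"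
      proof (rule optimal_plan_cyclic[OF opt _ Sb ae\<mu> ae\<nu> D, where A = A and U = U and V = V])
        show "transport_cost h \<gamma> < \<infinity>"
          using order.strict_trans2[OF small top_greatest] by simp
        fix i assume i: "i \<le> N"
        show "A i \<in> sets borel" using op by auto
        show "0 < measure \<gamma> (A i)"
        proof (cases "i = 0")
          case True
          have "(x, y) \<in> A 0" using r \<kappa> by (auto simp: A_def s_def)
          then obtain e where e: "0 < e" "ball (x, y) e \<subseteq> A 0" using op by (meson open_contains_ball)
          have "0 < measure \<gamma> (ball (x, y) e)" using xy(3) e by (simp add: supp_def)
          also have "\<dots> \<le> measure \<gamma> (A 0)"
            using e op by (intro \<gamma>.finite_measure_mono) (auto simp: sets)
          finally show ?thesis using True by simp
        next
          case False
          then show ?thesis using near[of "z i"] z0(3)[of i] i by (simp add: A_def)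
        qed
        show "A i \<subseteq> U i \<times> V i"
        proof
          fix p assume p: "p \<in> A i"
          then show "p \<in> U i \<times> V i"
            using dist_triangle[of "snd p" "z i" "fst p"] z0(1)
            by (auto simp: A_def U_def V_def mem_Times_iff dist_commute split: if_splits)
        qed
        show "U i \<in> sets borel" "V i \<in> sets borel" by (auto simp: U_def V_def)
        show "(if i = 0 then \<kappa> else 0) \<le> h (dist u v)" if "(u, v) \<in> A i" for u v
          using that h_nonneg[OF zero_le_dist[of u v]] by (cases "i = 0") (simp_all add: A_def)
        show "h (dist u v) \<le> h (dist (z i) (z (i + 1)) + \<rho> s)"
          if "u \<in> U i" "v \<in> V (if i = N then 0 else Suc i)" for u v
        proof (rule h_mono)
          have "dist (z (i + 1)) v < 2 * r"
            using that(2) z0(2) r by (auto simp: V_def split: if_splits)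
          moreover have "dist u (z i) < r" using that(1) by (simp add: U_def dist_commute)
          moreover have "dist u v \<le> dist u (z i) + dist (z i) (z (i + 1)) + dist (z (i + 1)) v"
            using dist_triangle[of u v "z i"] dist_triangle[of "z i" v "z (i + 1)"] by linarith
          ultimately show "dist u v \<le> dist (z i) (z (i + 1)) + \<rho> s" using r by (simp add: r_def)
        qed auto
      qed (use \<kappa>0 r in \<open>auto intro!: h_nonneg simp: r_def\<close>)
      then have "\<kappa> \<le> (\<Sum>i\<le>N. h (dist (z i) (z (i + 1)) + \<rho> s))"
        by (simp add: sum.delta)
      then show False using \<kappa>(1) by (simp add: atLeast0AtMost)
    qed
  qed
qed

section \<open>A uniform slack on compact sets\<close>

definition (in cost_function) has_slack :: "'a::metric_space set \<Rightarrow> real \<Rightarrow> 'a \<Rightarrow> 'a \<Rightarrow> bool" where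
  "has_slack A \<delta> x y \<longleftrightarrow>
    (\<exists>N z. is_chain A x y N z \<and> (\<Sum>i=0..N. h (dist (z i) (z (i + 1)) + \<delta>)) < h (dist x y))"

context cost_function
begin

lemma has_slack_antimono:
  assumes "has_slack A \<delta> x y" "0 \<le> \<delta>'" "\<delta>' \<le> \<delta>"
  shows "has_slack A \<delta>' x y"
proof -
  obtain N z where z: "is_chain A x y N z" "(\<Sum>i=0..N. h (dist (z i) (z (i + 1)) + \<delta>)) < h (dist x y)"
    using assms(1) by (auto simp: has_slack_def)
  have "(\<Sum>i=0..N. h (dist (z i) (z (i + 1)) + \<delta>')) \<le> (\<Sum>i=0..N. h (dist (z i) (z (i + 1)) + \<delta>))"
    using assms by (intro sum_mono h_mono) auto
  then show ?thesis using z by (auto simp: has_slack_def intro!: exI[of _ N] exI[of _ z])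
qed

lemma ex_slack:
  assumes "chain_condition h A" "x \<in> A" "y \<in> A" "x \<noteq> y"
  shows "\<exists>\<delta>>0. has_slack A \<delta> x y"
proof -
  obtain N z where z: "is_chain A x y N z" "(\<Sum>i=0..N. h (dist (z i) (z (i + 1)))) < h (dist x y)"
    using assms unfolding chain_condition_def by blast
  have "((\<lambda>\<delta>. \<Sum>i=0..N. h (dist (z i) (z (i + 1)) + \<delta>))
      \<longlongrightarrow> (\<Sum>i=0..N. h (dist (z i) (z (i + 1)) + 0))) (at_right 0)"
  proof (intro tendsto_sum tendsto_h tendsto_add tendsto_const tendsto_ident_at)
    show "\<forall>\<^sub>F \<delta> in at_right 0. 0 \<le> dist (z i) (z (i + 1)) + \<delta>" for i
      by (simp add: eventually_at_filter)
  qed simp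
  then have "\<forall>\<^sub>F \<delta> in at_right 0. (\<Sum>i=0..N. h (dist (z i) (z (i + 1)) + \<delta>)) < h (dist x y)"
    using z(2) by (intro order_tendstoD(2)) auto
  moreover have "\<forall>\<^sub>F \<delta> in at_right (0::real). 0 < \<delta>"
    by (simp add: eventually_at_filter)
  ultimately have "\<forall>\<^sub>F \<delta> in at_right 0. 0 < \<delta> \<and> (\<Sum>i=0..N. h (dist (z i) (z (i + 1)) + \<delta>)) < h (dist x y)"
    by (rule eventually_conj[rotated])
  then obtain \<delta> where "0 < \<delta>" "(\<Sum>i=0..N. h (dist (z i) (z (i + 1)) + \<delta>)) < h (dist x y)"
    using eventually_happens'[OF trivial_limit_at_right_real] by blast
  then show ?thesis using z(1) unfolding has_slack_def by blast
qed

text \<open>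
  A sequence of pairs whose slack tends to \<open>0\<close> would accumulate at a pair with positive slack.  The
  chain of the limit pair, with its end points replaced, serves the nearby pairs with a smaller
  slack.
\<close>

lemma uniform_slack:
  assumes A: "compact A" "chain_condition h A" and t: "0 < t"
  shows "\<exists>\<delta>>0. \<forall>x\<in>A. \<forall>y\<in>A. t \<le> dist x y \<longrightarrow> has_slack A \<delta> x y"
proof (rule ccontr)
  assume no: "\<not> ?thesis"
  have "\<exists>p\<in>A \<times> A. t \<le> dist (fst p) (snd p) \<and> \<not> has_slack A (1 / real (Suc n)) (fst p) (snd p)" for n
  proof -
    have "0 < 1 / real (Suc n)" by simp
    with no obtain x y where "x \<in> A" "y \<in> A" "t \<le> dist x y" "\<not> has_slack A (1 / real (Suc n)) x y"
      by blast
    then show ?thesis by (intro bexI[of _ "(x, y)"]) auto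
  qed
  then obtain p where p: "\<And>n. p n \<in> A \<times> A" "\<And>n. t \<le> dist (fst (p n)) (snd (p n))"
    "\<And>n. \<not> has_slack A (1 / real (Suc n)) (fst (p n)) (snd (p n))" by metis
  obtain q r where q: "q \<in> A \<times> A" "strict_mono r" "(p \<circ> r) \<longlonglongrightarrow> q"
    using compact_imp_seq_compact[OF compact_Times[OF A(1) A(1)]] p(1) unfolding seq_compact_def by metis
  obtain x y where xy: "q = (x, y)" by (cases q)
  define u v where "u n = fst (p (r n))" and "v n = snd (p (r n))" for n
  have uv: "u \<longlonglongrightarrow> x" "v \<longlonglongrightarrow> y"
    using tendsto_fst[OF q(3)] tendsto_snd[OF q(3)] unfolding u_def v_def xy o_def by simp_all
  have uvA: "u n \<in> A" "v n \<in> A" "t \<le> dist (u n) (v n)" for n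
    using p(1)[of "r n"] p(2)[of "r n"] by (auto simp: u_def v_def mem_Times_iff)
  have dist: "(\<lambda>n. dist (u n) (v n)) \<longlonglongrightarrow> dist x y" by (intro tendsto_dist uv)
  then have "t \<le> dist x y" by (rule LIMSEQ_le_const) (use uvA in auto)
  then have "x \<noteq> y" using t by auto
  moreover have "x \<in> A" "y \<in> A" using q(1) xy by auto
  ultimately obtain \<delta> where \<delta>: "0 < \<delta>" "has_slack A \<delta> x y" using ex_slack[OF A(2)] by blast
  then obtain N z where z: "is_chain A x y N z"
    "(\<Sum>i=0..N. h (dist (z i) (z (i + 1)) + \<delta>)) < h (dist x y)" by (auto simp: has_slack_def)
  have "(\<lambda>n. h (dist (u n) (v n))) \<longlonglongrightarrow> h (dist x y)"
    by (rule tendsto_h[OF dist]) auto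
  then have e1: "\<forall>\<^sub>F n in sequentially. (\<Sum>i=0..N. h (dist (z i) (z (i + 1)) + \<delta>)) < h (dist (u n) (v n))"
    using z(2) by (rule order_tendstoD(1))
  have e2: "\<forall>\<^sub>F n in sequentially. dist (u n) x < \<delta> / 4" "\<forall>\<^sub>F n in sequentially. dist (v n) y < \<delta> / 4"
    using \<delta>(1) by (intro tendstoD[OF uv(1)] tendstoD[OF uv(2)]; simp)+
  have "(\<lambda>n. 1 / real (Suc n)) \<longlonglongrightarrow> 0" by (rule LIMSEQ_Suc[OF lim_1_over_n])
  from LIMSEQ_subseq_LIMSEQ[OF this q(2)]
  have e3: "\<forall>\<^sub>F n in sequentially. 1 / real (Suc (r n)) < \<delta> / 2"
    unfolding o_def using \<delta>(1) by (intro order_tendstoD(2)) auto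
  have "\<forall>\<^sub>F n in sequentially. False"
    using e1 e2 e3
  proof eventually_elim
    case (elim n)
    (* Each of the two ends of a step moves by at most \<open>\<delta> / 4\<close>, which leaves the slack \<open>\<delta> / 2\<close>. *)
    define z' where "z' i = (if i = 0 then u n else if i = N + 1 then v n else z i)" for i
    have close: "dist (z' i) (z i) \<le> \<delta> / 4" for i
      using z(1) elim \<delta>(1) by (auto simp: z'_def is_chain_def)
    have "is_chain A (u n) (v n) N z'"
      using z(1) uvA by (auto simp: is_chain_def z'_def)
    moreover have "(\<Sum>i=0..N. h (dist (z' i) (z' (i + 1)) + 1 / real (Suc (r n))))
        \<le> (\<Sum>i=0..N. h (dist (z i) (z (i + 1)) + \<delta>))"
    proof (intro sum_mono h_mono)
      fix i
      have "dist (z' i) (z' (i + 1)) \<le> dist (z' i) (z i) + dist (z i) (z (i + 1)) + dist (z (i + 1)) (z' (i + 1))"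
        using dist_triangle[of "z' i" "z' (i + 1)" "z i"] dist_triangle[of "z i" "z' (i + 1)" "z (i + 1)"]
        by linarith
      then show "dist (z' i) (z' (i + 1)) + 1 / real (Suc (r n)) \<le> dist (z i) (z (i + 1)) + \<delta>"
        using close[of i] close[of "i + 1"] elim(4) dist_commute[of "z (i + 1)" "z' (i + 1)"] by linarith
      show "0 \<le> dist (z' i) (z' (i + 1)) + 1 / real (Suc (r n))" by simp
    qed
    ultimately have "has_slack A (1 / real (Suc (r n))) (u n) (v n)"
      unfolding has_slack_def using elim(1) by (meson le_less_trans)
    then show False using p(3)[of "r n"] by (simp add: u_def v_def)
  qed
  then show False by simp
qed

text \<open>
  The supremum of the slacks that serve all pairs at distance at least \<open>t\<close> is nondecreasing in \<open>t\<close>.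
  Half of it is below some such slack, and is therefore itself a slack; the bound \<open>1\<close> keeps the
  supremum finite when no such pairs exist.
\<close>

lemma ex_mono_slack:
  assumes A: "compact A" "chain_condition h A"
  shows "\<exists>\<rho>. chain_slack h A \<rho> \<and> mono_on {0..} \<rho>"
proof -
  define D where "D t = {\<delta>. 0 < \<delta> \<and> \<delta> \<le> 1 \<and> (\<forall>x\<in>A. \<forall>y\<in>A. t \<le> dist x y \<longrightarrow> has_slack A \<delta> x y)}" for t
  define \<rho> where "\<rho> t = (if t \<le> 0 then 0 else Sup (D t) / 2)" for t
  have bdd: "bdd_above (D t)" for t by (auto simp: D_def intro!: bdd_aboveI[of _ 1])
  have ne: "D t \<noteq> {}" if t: "0 < t" for t
  proof -
    obtain \<delta> where \<delta>: "0 < \<delta>" "\<And>x y. x \<in> A \<Longrightarrow> y \<in> A \<Longrightarrow> t \<le> dist x y \<Longrightarrow> has_slack A \<delta> x y"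
      using uniform_slack[OF A t] by blast
    then have "min \<delta> 1 \<in> D t"
      by (auto simp: D_def intro: has_slack_antimono[where \<delta> = \<delta>])
    then show ?thesis by auto
  qed
  have pos: "0 < Sup (D t)" if t: "0 < t" for t
  proof -
    obtain \<delta> where "\<delta> \<in> D t" using ne[OF t] by auto
    then show ?thesis using cSup_upper[OF _ bdd, of \<delta> t] by (auto simp: D_def)
  qed
  have slack: "has_slack A (\<rho> (dist x y)) x y" if xy: "x \<in> A" "y \<in> A" "x \<noteq> y" for x y
  proof -
    have t: "0 < dist x y" using xy by simp
    have "\<rho> (dist x y) < Sup (D (dist x y))" using pos[OF t] t by (simp add: \<rho>_def)
    then obtain \<delta> where \<delta>: "\<delta> \<in> D (dist x y)" "\<rho> (dist x y) < \<delta>"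
      using less_cSupD[OF ne[OF t]] by blast
    have "has_slack A \<delta> x y" using \<delta>(1) xy by (simp add: D_def)
    moreover have "0 \<le> \<rho> (dist x y)" using pos[OF t] t by (simp add: \<rho>_def)
    ultimately show ?thesis using less_imp_le[OF \<delta>(2)] by (rule has_slack_antimono)
  qed
  have "chain_slack h A \<rho>"
    unfolding chain_slack_def using slack pos by (auto simp: \<rho>_def has_slack_def)
  moreover have "mono_on {0..} \<rho>"
  proof (rule mono_onI)
    fix s t :: real assume st: "s \<in> {0..}" "t \<in> {0..}" "s \<le> t"
    show "\<rho> s \<le> \<rho> t"
    proof (cases "s = 0")
      case True
      then show ?thesis using pos[of t] st by (auto simp: \<rho>_def)
    next
      case False
      then have s: "0 < s" using st by simp
      have "D s \<subseteq> D t" using st(3) by (auto simp: D_def)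
      then have "Sup (D s) \<le> Sup (D t)" using ne[OF s] bdd by (intro cSup_subset_mono)
      then show ?thesis using s st by (simp add: \<rho>_def)
    qed
  qed
  ultimately show ?thesis by blast
qed

lemma slack_modulus_pos:
  assumes "borel_prob \<mu>" "emeasure \<mu> (supp \<mu>) = 1" "compact (supp \<mu>)" "chain_slack h (supp \<mu>) \<rho>" "0 < t"
  shows "0 < slack_modulus h \<mu> \<rho> t"
proof -
  have "0 < \<rho> t / 4" using assms by (simp add: chain_slack_def)
  then show ?thesis
    unfolding slack_modulus_def using h_pos assms
    by (intro mult_pos_pos min_ball_mass_pos supp_nonempty) auto
qed

lemma gauge_fun_slack_modulus:
  assumes \<mu>: "borel_prob \<mu>" "emeasure \<mu> (supp \<mu>) = 1" "compact (supp \<mu>)"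
    and \<rho>: "chain_slack h (supp \<mu>) \<rho>" "mono_on {0..} \<rho>"
  shows "gauge_fun (slack_modulus h \<mu> \<rho>)"
proof -
  have \<rho>0: "0 \<le> \<rho> t" if "0 \<le> t" for t
    using \<rho>(1) that by (cases "t = 0") (auto simp: chain_slack_def less_imp_le)
  note ne = supp_nonempty[OF \<mu>(2)]
  have nonneg: "0 \<le> slack_modulus h \<mu> \<rho> t" if "0 \<le> t" for t
    unfolding slack_modulus_def using \<rho>0[OF that] ne by (intro mult_nonneg_nonneg min_ball_mass_nonneg h_nonneg) auto
  have "mono_on {0..} (slack_modulus h \<mu> \<rho>)"
  proof (rule mono_onI)
    fix s t :: real assume st: "s \<in> {0..}" "t \<in> {0..}" "s \<le> t"
    have "\<rho> s / 4 \<le> \<rho> t / 4" using \<rho>(2) st by (auto simp: mono_on_def)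
    then show "slack_modulus h \<mu> \<rho> s \<le> slack_modulus h \<mu> \<rho> t"
      unfolding slack_modulus_def using \<rho>0[of s] st ne
      by (intro mult_mono min_ball_mass_mono[OF \<mu>(1)] h_mono h_nonneg min_ball_mass_nonneg) auto
  qed
  then show ?thesis
    using nonneg slack_modulus_pos[OF \<mu> \<rho>(1)] by (auto simp: gauge_fun_def)
qed

end

section \<open>Optimality from a pair of potentials\<close>

text \<open>
  Linear duality.  The integral of \<open>\<phi> u + \<psi> v\<close> depends on the marginals only, bounds the cost of
  every plan from below, and equals the cost of \<open>\<gamma>\<close>.  Adding \<open>B\<close> to each potential makes all integrands
  nonnegative.
\<close>

lemma (in cost_function) optimal_planI_potentials:
  fixes \<mu> \<nu> :: "'a::metric_space measure" and \<phi> \<psi> :: "'a \<Rightarrow> real"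
  assumes \<gamma>: "\<gamma> \<in> plans \<mu> \<nu>" and S: "S \<in> sets borel" "AE x in \<mu>. x \<in> S" "AE x in \<nu>. x \<in> S"
    and [measurable]: "\<phi> \<in> borel_measurable borel" "\<psi> \<in> borel_measurable borel"
    and bounded: "\<And>u. - B \<le> \<phi> u" "\<And>v. - B \<le> \<psi> v"
    and le: "\<And>u v. u \<in> S \<Longrightarrow> v \<in> S \<Longrightarrow> \<phi> u + \<psi> v \<le> h (dist u v)"
    and contact: "AE p in \<gamma>. h (dist (fst p) (snd p)) \<le> \<phi> (fst p) + \<psi> (snd p)"
    and fin: "0 \<le> B"
  shows "optimal_plan h \<mu> \<nu> \<gamma>"
proof -
  define P where "P p = ennreal (\<phi> (fst p) + B) + ennreal (\<psi> (snd p) + B)" for p :: "'a \<times> 'a"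
  define C where "C p = ennreal (h (dist (fst p) (snd p)))" for p :: "'a \<times> 'a"
  have [measurable]: "C \<in> borel_measurable borel" unfolding C_def by measurable
  have cost: "transport_cost h G = (\<integral>\<^sup>+p. C p \<partial>G)" for G
    unfolding transport_cost_def C_def by (intro nn_integral_cong) auto
  have P_eq: "P p = ennreal (\<phi> (fst p) + \<psi> (snd p) + 2 * B)" for p
    using bounded[of "fst p"] bounded(2)[of "snd p"]
    by (simp add: P_def ennreal_plus[symmetric] algebra_simps del: ennreal_plus)
  have C_eq: "C p + ennreal (2 * B) = ennreal (h (dist (fst p) (snd p)) + 2 * B)" for p
    using fin h_nonneg by (simp add: C_def ennreal_plus)
  have int: "(\<integral>\<^sup>+p. P p \<partial>G) = (\<integral>\<^sup>+u. ennreal (\<phi> u + B) \<partial>\<mu>) + (\<integral>\<^sup>+v. ennreal (\<psi> v + B) \<partial>\<nu>)"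
    and add: "(\<integral>\<^sup>+p. C p + ennreal (2 * B) \<partial>G) = transport_cost h G + ennreal (2 * B)"
    if G: "G \<in> plans \<mu> \<nu>" for G
  proof -
    note g = plansD[OF G]
    interpret G: prob_space G using g(1) by (rule borel_probD)
    note [measurable_cong] = borel_probD(2)[OF g(1)]
    have 1: "fst \<in> G \<rightarrow>\<^sub>M borel" "snd \<in> G \<rightarrow>\<^sub>M borel"
      by (simp_all add: measurable_cong_sets[OF borel_probD(2)[OF g(1)] refl] borel_measurable_fst_snd)
    have "(\<integral>\<^sup>+p. P p \<partial>G) = (\<integral>\<^sup>+p. ennreal (\<phi> (fst p) + B) \<partial>G) + (\<integral>\<^sup>+p. ennreal (\<psi> (snd p) + B) \<partial>G)"
      unfolding P_def by (intro nn_integral_add) auto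
    moreover have "(\<integral>\<^sup>+p. ennreal (\<phi> (fst p) + B) \<partial>G) = (\<integral>\<^sup>+u. ennreal (\<phi> u + B) \<partial>\<mu>)"
      using 1(1) by (subst g(4)[symmetric], subst nn_integral_distr) auto
    moreover have "(\<integral>\<^sup>+p. ennreal (\<psi> (snd p) + B) \<partial>G) = (\<integral>\<^sup>+v. ennreal (\<psi> v + B) \<partial>\<nu>)"
      using 1(2) by (subst g(5)[symmetric], subst nn_integral_distr) auto
    ultimately show "(\<integral>\<^sup>+p. P p \<partial>G) = (\<integral>\<^sup>+u. ennreal (\<phi> u + B) \<partial>\<mu>) + (\<integral>\<^sup>+v. ennreal (\<psi> v + B) \<partial>\<nu>)"
      by simp
    show "(\<integral>\<^sup>+p. C p + ennreal (2 * B) \<partial>G) = transport_cost h G + ennreal (2 * B)"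
      unfolding cost by (subst nn_integral_add) (auto simp: G.emeasure_space_1)
  qed
  have "transport_cost h \<gamma> \<le> transport_cost h \<gamma>'" if \<gamma>': "\<gamma>' \<in> plans \<mu> \<nu>" for \<gamma>'
  proof -
    have "transport_cost h \<gamma> + ennreal (2 * B) \<le> (\<integral>\<^sup>+p. P p \<partial>\<gamma>)"
      unfolding add[OF \<gamma>, symmetric] C_eq P_eq using contact
      by (intro nn_integral_mono_AE) (auto elim!: eventually_mono intro!: ennreal_leI)
    also have "\<dots> = (\<integral>\<^sup>+p. P p \<partial>\<gamma>')" by (simp only: int[OF \<gamma>] int[OF \<gamma>'])
    also have "\<dots> \<le> transport_cost h \<gamma>' + ennreal (2 * B)"
    proof -
      have "AE p in \<gamma>'. P p \<le> C p + ennreal (2 * B)"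
        using plans_AE_fst[OF \<gamma>' S(1,2)] plans_AE_snd[OF \<gamma>' S(1,3)]
        unfolding C_eq P_eq by eventually_elim (intro ennreal_leI add_right_mono le)
      then show ?thesis unfolding add[OF \<gamma>', symmetric] by (rule nn_integral_mono_AE)
    qed
    finally have "ennreal (2 * B) + transport_cost h \<gamma> \<le> ennreal (2 * B) + transport_cost h \<gamma>'"
      by (simp only: add.commute)
    then show ?thesis by (auto simp only: ennreal_add_left_cancel_le ennreal_neq_top infinity_ennreal_def)
  qed
  then show ?thesis using \<gamma> by (simp add: optimal_plan_def)
qed

locale linfty_bound = cost_function h for h +
  fixes \<mu> :: "'a::metric_space measure" and \<omega> :: "real \<Rightarrow> real"
  assumes prob: "borel_prob \<mu>" and full: "emeasure \<mu> (supp \<mu>) = 1"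
    and gauge: "gauge_fun \<omega>" and estimate: "linfty_estimate h \<mu> \<omega>"
begin

sublocale prob_space \<mu> using prob by (rule borel_probD)

abbreviation S where "S \<equiv> supp \<mu>"

lemmas sets_\<mu> [measurable_cong, simp] = borel_probD(2)[OF prob]
lemmas space_\<mu> [simp] = borel_probD(3)[OF prob]

lemma S_borel [measurable]: "S \<in> sets borel"
  using closed_supp[OF prob] by auto

lemma AE_S: "AE x in \<mu>. x \<in> S"
  by (rule AE_in_of_emeasure_1[OF prob S_borel full])

lemma \<omega>_mono: "0 \<le> s \<Longrightarrow> s \<le> t \<Longrightarrow> \<omega> s \<le> \<omega> t"
  using gauge by (auto simp: gauge_fun_def mono_on_def)

lemma \<omega>_pos: "0 < t \<Longrightarrow> 0 < \<omega> t"
  using gauge by (auto simp: gauge_fun_def)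

lemma eval_ext_ge:
  assumes "0 \<le> t" "ennreal t \<le> s"
  shows "ennreal (\<omega> t) \<le> eval_ext \<omega> s"
proof (cases "s = \<infinity>")
  case True
  then show ?thesis using assms(1) by (auto simp: eval_ext_def intro!: SUP_upper)
next
  case False
  then have "t \<le> enn2real s"
    using assms by (cases s) auto
  then show ?thesis using assms False by (auto simp: eval_ext_def intro!: ennreal_leI \<omega>_mono)
qed

lemma measure_pos_near:
  assumes "x \<in> S" "0 < r" "A \<in> sets borel" "\<And>u. u \<in> S \<Longrightarrow> dist u x < r \<Longrightarrow> u \<in> A"
  shows "0 < measure \<mu> A"
proof -
  have "0 < measure \<mu> (ball x r)" using assms by (simp add: supp_def)
  also have "\<dots> \<le> measure \<mu> A"
    using AE_S assms(3) by (intro finite_measure_mono_AE) (auto elim!: eventually_mono intro!: assms(4) simp: dist_commute)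
  finally show ?thesis .
qed

lemma AE_notin_of_measure_0:
  assumes "\<not> 0 < measure \<mu> A" "A \<in> sets borel"
  shows "AE u in \<mu>. u \<notin> A"
proof (rule AE_not_in, rule null_setsI)
  have "measure \<mu> A = 0" using assms(1) by (simp only: zero_less_measure_iff not_not)
  then show "emeasure \<mu> A = 0" by (simp only: emeasure_eq_measure ennreal_0)
  show "A \<in> sets \<mu>" using assms(2) by simp
qed

end

section \<open>Plans that collapse mass onto one point\<close>

text \<open>
  Mass is to be moved to \<open>y\<close>.  The function \<open>f\<close> is one-sided Lipschitz with respect to the cost; it will
  be the potential of the points that stay in place.
\<close>

locale collapse = linfty_bound h \<mu> \<omega> for h and \<mu> :: "'a::metric_space measure" and \<omega> +
  fixes f :: "'a \<Rightarrow> real" and y :: 'a and B :: real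
  assumes f_borel [measurable]: "f \<in> borel_measurable borel" and f_bounded: "\<And>u. \<bar>f u\<bar> \<le> B"
    and f_lip: "\<And>u v. u \<in> S \<Longrightarrow> v \<in> S \<Longrightarrow> f u - f v \<le> h (dist u v)" and y: "y \<in> S"
begin

definition excess :: "'a \<Rightarrow> real" where "excess u = h (dist u y) - f u"

lemma excess_borel [measurable]: "excess \<in> borel_measurable borel"
  unfolding excess_def by measurable

lemma dist_borel [measurable]: "(\<lambda>u. dist u y) \<in> borel_measurable borel"
  by (intro borel_measurable_continuous_onI continuous_intros)

lemma level_sets [measurable]: "{u. excess u < a} \<in> sets borel" "{u. excess u = a} \<in> sets borel"
  "{u. excess u \<le> a} \<in> sets borel" "{u. excess u < a \<and> t \<le> dist u y} \<in> sets borel"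
  "{u. excess u = a \<and> t \<le> dist u y} \<in> sets borel"
  by measurable

text \<open>
  A coin with success probability \<open>s\<close> decides whether the points with excess equal to \<open>a\<close> move, so that
  they move with mass fraction \<open>s\<close>.  The plan is optimal for the potentials
  \<open>\<phi> u = min (f u) (h (dist u y) - a)\<close> and \<open>\<psi> v = - f v\<close>, except that \<open>\<psi> y = a\<close>: a point that stays has
  excess at least \<open>a\<close>, so that its potential is \<open>f u\<close>, and a point that moves has excess at most \<open>a\<close>.
  The bound \<open>- f y \<le> a\<close> says that \<open>a\<close> is at least the excess of \<open>y\<close> itself, and makes
  \<open>\<phi> y + \<psi> y\<close> nonnegative.
\<close>

lemma collapse_bound:
  assumes a: "- f y \<le> a" and s: "0 \<le> s" "s \<le> 1" and t: "0 \<le> t"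
    and moved: "0 < measure \<mu> {u. excess u < a \<and> t \<le> dist u y} \<or>
      0 < s \<and> 0 < measure \<mu> {u. excess u = a \<and> t \<le> dist u y}"
  shows "ennreal (\<omega> t) \<le> (\<integral>\<^sup>+u\<in>{u. excess u < a}. ennreal (h (dist u y)) \<partial>\<mu>)
    + ennreal s * (\<integral>\<^sup>+u\<in>{u. excess u = a}. ennreal (h (dist u y)) \<partial>\<mu>)"
proof -
  define E where "E b = {u. excess u < a} \<union> (if b then {u. excess u = a} else {})" for b
  define T where "T b u = (u, if u \<in> E b then y else u)" for b u
  have E[measurable]: "E b \<in> sets borel" for b unfolding E_def by auto
  have T[measurable]: "T b \<in> borel \<rightarrow>\<^sub>M borel" for b
  proof -
    have "(\<lambda>u. if u \<in> E b then (u, y) else (u, u)) \<in> borel \<rightarrow>\<^sub>M (borel :: ('a \<times> 'a) measure)"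
      by (intro measurable_If borel_measurable_continuous_onI continuous_intros) auto
    moreover have "(\<lambda>u. if u \<in> E b then (u, y) else (u, u)) = T b" by (auto simp: T_def fun_eq_iff)
    ultimately show ?thesis by simp
  qed
  have T\<mu>: "T b \<in> \<mu> \<rightarrow>\<^sub>M borel" for b by measurable
  define M where "M b = distr \<mu> borel (T b)" for b
  have M: "borel_prob (M b)" for b unfolding M_def by (intro borel_prob_distr prob T)
  have kernel: "M \<in> measure_pmf (bernoulli_pmf s) \<rightarrow>\<^sub>M subprob_algebra borel"
    using borel_probD[OF M]
    by (auto simp: space_subprob_algebra prob_space_imp_subprob_space)
  define \<gamma> where "\<gamma> = measure_pmf (bernoulli_pmf s) \<bind> M"
  have sets_\<gamma>: "sets \<gamma> = sets borel"
    unfolding \<gamma>_def by (rule sets_bind_measurable[OF kernel]) simp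
  have int: "(\<integral>\<^sup>+p. F p \<partial>\<gamma>) = (\<integral>\<^sup>+u. F (T True u) \<partial>\<mu>) * ennreal s + (\<integral>\<^sup>+u. F (T False u) \<partial>\<mu>) * ennreal (1 - s)"
    if F[measurable]: "F \<in> borel_measurable borel" for F
    unfolding \<gamma>_def nn_integral_bind[OF F kernel] using s
    by (simp add: M_def nn_integral_distr)
  have ae: "(AE p in \<gamma>. P p) \<longleftrightarrow> (\<forall>b\<in>set_pmf (bernoulli_pmf s). AE u in \<mu>. P (T b u))"
    if P: "Measurable.pred borel P" for P
    unfolding \<gamma>_def AE_bind[OF kernel P] AE_measure_pmf_iff M_def
    using P by (subst AE_distr_iff[OF T\<mu>]) (auto simp: pred_def)
  have one: "v * ennreal s + v * ennreal (1 - s) = v" for v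
    using s by (simp add: distrib_left[symmetric] ennreal_plus[symmetric] del: ennreal_plus)
  have mix: "(v + w) * ennreal s + v * ennreal (1 - s) = v + ennreal s * w" for v w
  proof -
    have "(v + w) * ennreal s + v * ennreal (1 - s) = (v * ennreal s + v * ennreal (1 - s)) + ennreal s * w"
      by (simp only: distrib_right mult.commute[of "ennreal s" w] add.assoc add.commute[of "w * ennreal s"])
    then show ?thesis by (simp only: one)
  qed
  have "emeasure \<gamma> (space \<gamma>) = 1"
    using int[of "\<lambda>_. 1"] one[of 1] by (simp add: emeasure_space_1[simplified])
  then have \<gamma>: "borel_prob \<gamma>" by (auto simp: borel_prob_def sets_\<gamma> intro: prob_spaceI)
  define \<nu> where "\<nu> = distr \<gamma> borel snd"
  have \<nu>: "borel_prob \<nu>" unfolding \<nu>_def by (intro borel_prob_distr \<gamma> borel_measurable_fst_snd)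
  have m: "fst \<in> \<gamma> \<rightarrow>\<^sub>M borel" "snd \<in> \<gamma> \<rightarrow>\<^sub>M borel"
    by (simp_all add: measurable_cong_sets[OF sets_\<gamma> refl] borel_measurable_fst_snd)
  have plan: "\<gamma> \<in> plans \<mu> \<nu>"
  proof (rule plansI[OF prob \<nu> sets_\<gamma>])
    fix A :: "'a set" assume [measurable]: "A \<in> sets borel"
    have "(\<integral>\<^sup>+p. indicator A (fst p) \<partial>\<gamma>) = emeasure \<mu> A * ennreal s + emeasure \<mu> A * ennreal (1 - s)"
      by (subst int) (auto simp: T_def)
    then show "(\<integral>\<^sup>+p. indicator A (fst p) \<partial>\<gamma>) = emeasure \<mu> A" using one by simp
    show "(\<integral>\<^sup>+p. indicator A (snd p) \<partial>\<gamma>) = emeasure \<nu> A"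
      unfolding \<nu>_def using nn_integral_distr[OF m(2), of "indicator A"] by simp
  qed
  have "AE p in \<gamma>. snd p \<in> S"
    using AE_S y by (subst ae) (auto simp: T_def elim!: eventually_mono)
  then have \<nu>S: "AE x in \<nu>. x \<in> S"
    unfolding \<nu>_def by (subst AE_distr_iff[OF m(2)]) auto
  then have "\<nu> \<in> probs_on S"
    using prob_space.emeasure_eq_1_AE[OF borel_probD(1)[OF \<nu>], of S] \<nu> by (simp add: probs_on_def borel_probD)
  moreover have "optimal_plan h \<mu> \<nu> \<gamma>"
  proof (rule optimal_planI_potentials[OF plan S_borel AE_S \<nu>S])
    define \<phi> where "\<phi> u = min (f u) (h (dist u y) - a)" for u
    define \<psi> where "\<psi> v = (if v = y then a else - f v)" for v
    show \<phi>m: "\<phi> \<in> borel_measurable borel" unfolding \<phi>_def by measurable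
    show \<psi>m: "\<psi> \<in> borel_measurable borel" unfolding \<psi>_def by measurable
    show "- (B + \<bar>a\<bar>) \<le> \<phi> u" for u
      using f_bounded[of u] h_nonneg[of "dist u y"] by (auto simp: \<phi>_def)
    show "- (B + \<bar>a\<bar>) \<le> \<psi> v" for v
      using f_bounded[of v] by (auto simp: \<psi>_def)
    show "0 \<le> B + \<bar>a\<bar>" using f_bounded[of y] by simp
    show "\<phi> u + \<psi> v \<le> h (dist u v)" if "u \<in> S" "v \<in> S" for u v
      using f_lip[OF that] by (auto simp: \<phi>_def \<psi>_def)
    show "AE p in \<gamma>. h (dist (fst p) (snd p)) \<le> \<phi> (fst p) + \<psi> (snd p)"
    proof (subst ae, safe)
      show "Measurable.pred borel (\<lambda>p. h (dist (fst p) (snd p)) \<le> \<phi> (fst p) + \<psi> (snd p))"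
        using \<phi>m \<psi>m by measurable
      show "AE u in \<mu>. h (dist (fst (T b u)) (snd (T b u))) \<le> \<phi> (fst (T b u)) + \<psi> (snd (T b u))" for b
        using a by (intro AE_I2) (auto simp: T_def E_def \<phi>_def \<psi>_def excess_def h_0 split: if_splits)
    qed
  qed
  ultimately have "eval_ext \<omega> (ess_dist \<gamma>) \<le> transport_cost h \<gamma>"
    using estimate by (auto simp: linfty_estimate_def)
  moreover have "ennreal t \<le> ess_dist \<gamma>"
  proof (rule ccontr)
    assume "\<not> ennreal t \<le> ess_dist \<gamma>"
    then have less: "ess_dist \<gamma> < ennreal t" by simp
    have less_t: "AE p in \<gamma>. dist (fst p) (snd p) < t"
      using esssup_AE[of "\<lambda>(x, y). ennreal (dist x y)" \<gamma>]
    proof eventually_elim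
      case (elim p)
      then have "ennreal (dist (fst p) (snd p)) < ennreal t"
        using less by (auto simp: ess_dist_def split_beta intro: le_less_trans)
      then show ?case by (simp add: ennreal_less_iff)
    qed
    have "Measurable.pred borel (\<lambda>p::'a\<times>'a. dist (fst p) (snd p) < t)"
      unfolding pred_def by (simp add: borel_open open_Collect_less continuous_on_dist continuous_on_fst continuous_on_snd)
    from ae[OF this] less_t
    have "\<forall>b\<in>set_pmf (bernoulli_pmf s). AE u in \<mu>. dist (fst (T b u)) (snd (T b u)) < t" by (rule iffD1)
    then have *: "AE u in \<mu>. u \<in> E b \<longrightarrow> dist u y < t" if "b \<in> set_pmf (bernoulli_pmf s)" for b
      using that by (auto simp: T_def elim!: ballE eventually_mono)
    note null = measure_eq_0_of_AE[OF prob]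
    from moved show False
    proof
      assume 1: "0 < measure \<mu> {u. excess u < a \<and> t \<le> dist u y}"
      obtain b where b: "b \<in> set_pmf (bernoulli_pmf s)" using set_pmf_not_empty[of "bernoulli_pmf s"] by blast
      have "AE u in \<mu>. u \<notin> {u. excess u < a \<and> t \<le> dist u y}"
        using *[OF b] by eventually_elim (auto simp: E_def)
      from null[OF _ this] 1 show False by simp
    next
      assume 1: "0 < s \<and> 0 < measure \<mu> {u. excess u = a \<and> t \<le> dist u y}"
      then have b: "True \<in> set_pmf (bernoulli_pmf s)" using s by (simp add: set_pmf_iff)
      have "AE u in \<mu>. u \<notin> {u. excess u = a \<and> t \<le> dist u y}"
        using *[OF b] by eventually_elim (auto simp: E_def)
      from null[OF _ this] 1 show False by simp
    qed
  qed
  ultimately have "ennreal (\<omega> t) \<le> transport_cost h \<gamma>"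
    using eval_ext_ge[OF t] order_trans by blast
  also have "transport_cost h \<gamma> = (\<integral>\<^sup>+p. ennreal (h (dist (fst p) (snd p))) \<partial>\<gamma>)"
    unfolding transport_cost_def by (intro nn_integral_cong) auto
  also have "\<dots> = (\<integral>\<^sup>+u\<in>E True. ennreal (h (dist u y)) \<partial>\<mu>) * ennreal s
      + (\<integral>\<^sup>+u\<in>E False. ennreal (h (dist u y)) \<partial>\<mu>) * ennreal (1 - s)"
  proof (subst int)
    have "(\<integral>\<^sup>+u. ennreal (h (dist (fst (T b u)) (snd (T b u)))) \<partial>\<mu>) = (\<integral>\<^sup>+u\<in>E b. ennreal (h (dist u y)) \<partial>\<mu>)" for b
      by (intro nn_integral_cong) (auto simp: T_def h_0)
    then show "(\<integral>\<^sup>+u. ennreal (h (dist (fst (T True u)) (snd (T True u)))) \<partial>\<mu>) * ennreal s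
      + (\<integral>\<^sup>+u. ennreal (h (dist (fst (T False u)) (snd (T False u)))) \<partial>\<mu>) * ennreal (1 - s)
      = (\<integral>\<^sup>+u\<in>E True. ennreal (h (dist u y)) \<partial>\<mu>) * ennreal s
      + (\<integral>\<^sup>+u\<in>E False. ennreal (h (dist u y)) \<partial>\<mu>) * ennreal (1 - s)" by simp
  qed measurable
  finally have "ennreal (\<omega> t) \<le> (\<integral>\<^sup>+u\<in>E True. ennreal (h (dist u y)) \<partial>\<mu>) * ennreal s
      + (\<integral>\<^sup>+u\<in>E False. ennreal (h (dist u y)) \<partial>\<mu>) * ennreal (1 - s)" .
  moreover have "(\<integral>\<^sup>+u\<in>E True. ennreal (h (dist u y)) \<partial>\<mu>)
      = (\<integral>\<^sup>+u\<in>{u. excess u < a}. ennreal (h (dist u y)) \<partial>\<mu>) + (\<integral>\<^sup>+u\<in>{u. excess u = a}. ennreal (h (dist u y)) \<partial>\<mu>)"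
    by (subst nn_integral_add[symmetric]) (auto intro!: nn_integral_cong simp: E_def split: split_indicator)
  moreover have "E False = {u. excess u < a}" by (simp add: E_def)
  ultimately show ?thesis by (simp only: mix)
qed

text \<open>
  Since \<open>f\<close> is bounded, so is the cost of moving to \<open>y\<close> on each sublevel set of the excess, even if the
  support is unbounded.
\<close>

lemma cost_on_sublevel_le:
  assumes "A \<in> sets borel" "\<And>u. u \<in> A \<Longrightarrow> excess u \<le> b"
  shows "(\<integral>\<^sup>+u\<in>A. ennreal (h (dist u y)) \<partial>\<mu>) \<le> ennreal (b + B) * emeasure \<mu> A"
proof -
  have "(\<integral>\<^sup>+u\<in>A. ennreal (h (dist u y)) \<partial>\<mu>) \<le> (\<integral>\<^sup>+u. ennreal (b + B) * indicator A u \<partial>\<mu>)"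
  proof (intro nn_integral_mono)
    fix u
    show "ennreal (h (dist u y)) * indicator A u \<le> ennreal (b + B) * indicator A u"
      using assms(2)[of u] f_bounded[of u] by (auto simp: excess_def split: split_indicator intro!: ennreal_leI)
  qed
  also have "\<dots> = ennreal (b + B) * emeasure \<mu> A"
    using assms(1) by (intro nn_integral_cmult_indicator) simp
  finally show ?thesis .
qed

text \<open>
  When the level set itself supplies the mass that is moved by at least \<open>t\<close>, an arbitrarily small
  fraction of it suffices, and its cost disappears in the limit.
\<close>

lemma bound_below_level:
  assumes a: "- f y \<le> a" and t: "0 \<le> t" and pos: "0 < measure \<mu> {u. excess u = a \<and> t \<le> dist u y}"
  shows "ennreal (\<omega> t) \<le> (\<integral>\<^sup>+u\<in>{u. excess u < a}. ennreal (h (dist u y)) \<partial>\<mu>)"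
proof (rule ennreal_le_epsilon)
  fix e :: real assume e: "0 < e"
  define K where "K = \<bar>a + B\<bar> + 1"
  define s where "s = min 1 (e / K)"
  have K: "0 < K" by (simp add: K_def)
  have s: "0 < s" "s \<le> 1" "s * K \<le> e"
    using e K by (auto simp: s_def min_def field_simps)
  let ?I = "\<integral>\<^sup>+u\<in>{u. excess u = a}. ennreal (h (dist u y)) \<partial>\<mu>"
  have "?I \<le> ennreal (a + B) * emeasure \<mu> {u. excess u = a}"
    by (rule cost_on_sublevel_le) auto
  also have "\<dots> \<le> ennreal K * 1"
    by (intro mult_mono ennreal_leI emeasure_le_1) (auto simp: K_def)
  finally have I: "?I \<le> ennreal K" by simp
  have "ennreal (\<omega> t) \<le> (\<integral>\<^sup>+u\<in>{u. excess u < a}. ennreal (h (dist u y)) \<partial>\<mu>) + ennreal s * ?I"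
    using s pos by (intro collapse_bound[OF a _ _ t]) auto
  also have "\<dots> \<le> (\<integral>\<^sup>+u\<in>{u. excess u < a}. ennreal (h (dist u y)) \<partial>\<mu>) + ennreal s * ennreal K"
    using I by (intro add_left_mono mult_left_mono) auto
  also have "ennreal s * ennreal K \<le> ennreal e"
    using s K by (simp add: ennreal_mult[symmetric] ennreal_leI)
  finally show "ennreal (\<omega> t) \<le> (\<integral>\<^sup>+u\<in>{u. excess u < a}. ennreal (h (dist u y)) \<partial>\<mu>) + ennreal e"
    by (simp add: add_left_mono)
qed

text \<open>
  Collapse at levels \<open>b\<close> that decrease to \<open>a\<close>: the strips between \<open>a\<close> and \<open>b\<close> decrease to the empty set, and
  the cost on them is bounded.
\<close>

lemma bound_up_to_level:
  assumes a: "- f y \<le> a" and t: "0 \<le> t" and pos: "\<And>b. a < b \<Longrightarrow> 0 < measure \<mu> {u. excess u < b \<and> t \<le> dist u y}"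
  shows "ennreal (\<omega> t) \<le> (\<integral>\<^sup>+u\<in>{u. excess u \<le> a}. ennreal (h (dist u y)) \<partial>\<mu>)"
proof (rule ennreal_le_epsilon)
  fix e :: real assume e: "0 < e"
  define K where "K = \<bar>a + 1 + B\<bar> + 1"
  have K: "0 < K" by (simp add: K_def)
  define A where "A n = {u. a < excess u \<and> excess u < a + 1 / real (Suc n)}" for n
  have A[measurable]: "A n \<in> sets borel" for n unfolding A_def by measurable
  have "(\<lambda>n. measure \<mu> (A n)) \<longlonglongrightarrow> measure \<mu> (\<Inter>n. A n)"
  proof (rule finite_Lim_measure_decseq)
    show "range A \<subseteq> sets \<mu>" using A by auto
    show "decseq A"
    proof (rule decseq_SucI)
      fix n
      have "1 / real (Suc (Suc n)) \<le> 1 / real (Suc n)" by (intro divide_left_mono) auto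
      then show "A (Suc n) \<subseteq> A n" unfolding A_def by force
    qed
  qed
  moreover have "(\<Inter>n. A n) = {}"
  proof -
    have False if "\<forall>n. u \<in> A n" for u
    proof -
      have "0 < excess u - a" using that by (auto simp: A_def)
      then obtain n where "1 / real (Suc n) < excess u - a" using nat_approx_posE by blast
      moreover have "excess u < a + 1 / real (Suc n)" using that by (auto simp: A_def)
      ultimately show False by linarith
    qed
    then show ?thesis by auto
  qed
  ultimately have "(\<lambda>n. measure \<mu> (A n)) \<longlonglongrightarrow> 0" by simp
  then have "\<forall>\<^sub>F n in sequentially. measure \<mu> (A n) < e / K"
    using e K by (auto simp: order_tendsto_iff)
  then obtain n where n: "measure \<mu> (A n) < e / K" by (auto simp: eventually_sequentially)
  define b where "b = a + 1 / real (Suc n)"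
  have b: "a < b" "b \<le> a + 1" by (auto simp: b_def)
  let ?c = "\<lambda>u. ennreal (h (dist u y))"
  have "ennreal (\<omega> t) \<le> (\<integral>\<^sup>+u\<in>{u. excess u < b}. ?c u \<partial>\<mu>)"
    using collapse_bound[of b 0 t] a b t pos[OF b(1)] by simp
  also have "\<dots> \<le> (\<integral>\<^sup>+u. ?c u * indicator {u. excess u \<le> a} u + ?c u * indicator (A n) u \<partial>\<mu>)"
    by (intro nn_integral_mono) (auto simp: A_def b_def split: split_indicator)
  also have "\<dots> = (\<integral>\<^sup>+u\<in>{u. excess u \<le> a}. ?c u \<partial>\<mu>) + (\<integral>\<^sup>+u\<in>A n. ?c u \<partial>\<mu>)"
    by (intro nn_integral_add) auto
  also have "\<dots> \<le> (\<integral>\<^sup>+u\<in>{u. excess u \<le> a}. ?c u \<partial>\<mu>) + ennreal e"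
  proof (intro add_left_mono)
    have "(\<integral>\<^sup>+u\<in>A n. ?c u \<partial>\<mu>) \<le> ennreal (b + B) * emeasure \<mu> (A n)"
      by (rule cost_on_sublevel_le) (auto simp: A_def b_def)
    also have "\<dots> \<le> ennreal K * ennreal (e / K)"
    proof (rule mult_mono)
      show "ennreal (b + B) \<le> ennreal K" using b(2) by (intro ennreal_leI) (simp add: K_def)
      show "emeasure \<mu> (A n) \<le> ennreal (e / K)"
        unfolding emeasure_eq_measure using n by (intro ennreal_leI) simp
    qed auto
    also have "\<dots> = ennreal e" using e K by (simp add: ennreal_mult[symmetric])
    finally show "(\<integral>\<^sup>+u\<in>A n. ?c u \<partial>\<mu>) \<le> ennreal e" .
  qed
  finally show "ennreal (\<omega> t) \<le> (\<integral>\<^sup>+u\<in>{u. excess u \<le> a}. ?c u \<partial>\<mu>) + ennreal e" .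
qed

end

section \<open>Compactness of the support\<close>

context linfty_bound
begin

text \<open>
  With \<open>f = H\<close> on \<open>C\<close> and \<open>0\<close> elsewhere, the excess is \<open>h (dist u y) - H\<close> on \<open>C\<close> and \<open>h (dist u y)\<close>
  outside.  Collapse at the level \<open>a\<close>, the infimum of the excess on \<open>C\<close>.  An arbitrarily small
  part of \<open>C\<close> moves, by at least \<open>R\<close>, and the points outside \<open>C\<close> move at cost at most \<open>a\<close>.  Thus \<open>\<omega> R \<le> a\<close>, whereas \<open>a\<close> becomes as small as desired by choice of \<open>y\<close>.
\<close>

lemma no_gap:
  assumes C: "C \<in> sets borel" "C \<subseteq> S" "c \<in> C" and d: "d \<in> S - C" and R: "0 < R"
    and gap: "\<And>u v. u \<in> C \<Longrightarrow> v \<in> S - C \<Longrightarrow> R \<le> dist u v"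
  shows False
proof -
  note [measurable] = C(1)
  define H where "H = Inf {h (dist u v) | u v. u \<in> C \<and> v \<in> S - C}"
  have bdd: "bdd_below {h (dist u v) | u v. u \<in> C \<and> v \<in> S - C}"
    by (auto intro!: bdd_belowI[of _ 0] h_nonneg)
  have ne: "{h (dist u v) | u v. u \<in> C \<and> v \<in> S - C} \<noteq> {}" using C d by auto
  have H: "H \<le> h (dist u v)" if "u \<in> C" "v \<in> S - C" for u v
    unfolding H_def using that by (intro cInf_lower bdd) auto
  have H0: "0 \<le> H" unfolding H_def by (intro cInf_greatest ne) (auto intro!: h_nonneg)
  have "Inf {h (dist u v) | u v. u \<in> C \<and> v \<in> S - C} < H + \<omega> R / 2"
    using \<omega>_pos[OF R] by (simp add: H_def)
  from cInf_lessD[OF ne this]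
  (* The target is almost optimal for crossing the gap; the infimum need not be attained. *)
  obtain u0 y where uy: "u0 \<in> C" "y \<in> S - C" "h (dist u0 y) < H + \<omega> R / 2" by blast
  define f where "f u = H * indicator C u" for u
  interpret collapse h \<mu> \<omega> f y H
  proof
    show "f \<in> borel_measurable borel" unfolding f_def by measurable
    show "\<bar>f u\<bar> \<le> H" for u using H0 by (auto simp: f_def split: split_indicator)
    show "f u - f v \<le> h (dist u v)" if "u \<in> S" "v \<in> S" for u v
      using that H[of u v] H0 h_nonneg[of "dist u v"] by (auto simp: f_def split: split_indicator)
    show "y \<in> S" using uy by auto
  qed
  have excess_out: "excess u = h (dist u y)" if "u \<notin> C" for u using that by (simp add: excess_def f_def)
  have excess_in: "excess u = h (dist u y) - H" if "u \<in> C" for u using that by (simp add: excess_def f_def)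
  define a where "a = Inf ((\<lambda>u. h (dist u y) - H) ` C)"
  have bdd2: "bdd_below ((\<lambda>u. h (dist u y) - H) ` C)"
    by (rule bdd_belowI[of _ 0]) (use H uy in auto)
  have a_le: "a \<le> h (dist u y) - H" if "u \<in> C" for u
    unfolding a_def using that by (intro cINF_lower bdd2)
  have a0: "0 \<le> a" unfolding a_def using C H uy by (intro cINF_greatest) auto
  have a_small: "a < \<omega> R / 2" using a_le[OF uy(1)] uy(3) by simp
  have fy: "- f y \<le> a" using a0 uy by (simp add: f_def)
  let ?c = "\<lambda>u. ennreal (h (dist u y))"
  have const: "(\<integral>\<^sup>+u. ennreal a \<partial>\<mu>) = ennreal a"
    by (simp add: emeasure_space_1[simplified])
  have "ennreal (\<omega> R) \<le> ennreal a"
  proof (cases "0 < measure \<mu> {u. excess u = a \<and> R \<le> dist u y}")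
    case True
    have "ennreal (\<omega> R) \<le> (\<integral>\<^sup>+u\<in>{u. excess u < a}. ?c u \<partial>\<mu>)"
      using fy True R by (intro bound_below_level) auto
    also have "\<dots> \<le> (\<integral>\<^sup>+u. ennreal a \<partial>\<mu>)"
    proof (intro nn_integral_mono)
      fix u show "?c u * indicator {u. excess u < a} u \<le> ennreal a"
        using excess_out[of u] excess_in[of u] a_le[of u] by (cases "u \<in> C") (auto split: split_indicator intro!: ennreal_leI)
    qed
    finally show ?thesis by (simp only: const)
  next
    case False
    have ae: "AE u in \<mu>. u \<notin> {u. excess u = a \<and> R \<le> dist u y}"
      by (rule AE_notin_of_measure_0[OF False level_sets(5)])
    have "ennreal (\<omega> R) \<le> (\<integral>\<^sup>+u\<in>{u. excess u \<le> a}. ?c u \<partial>\<mu>)"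
    proof (rule bound_up_to_level[OF fy])
      fix b assume "a < b"
      then obtain u where u: "u \<in> C" "h (dist u y) - H < b"
        using cInf_lessD[of "(\<lambda>u. h (dist u y) - H) ` C" b] C unfolding a_def by auto
      have "open {u'. h (dist u' y) < b + H}"
        by (intro open_Collect_less continuous_on_h_dist' continuous_intros)
      moreover have "u \<in> {u'. h (dist u' y) < b + H}" using u by simp
      ultimately obtain r where r: "0 < r" "ball u r \<subseteq> {u'. h (dist u' y) < b + H}" by (rule openE)
      show "0 < measure \<mu> {u. excess u < b \<and> R \<le> dist u y}"
      proof (rule measure_pos_near[of u "min r R"])
        fix u' assume u': "u' \<in> S" "dist u' u < min r R"
        have "u' \<in> C"
        proof (rule ccontr)
          assume "u' \<notin> C"
          then show False using gap[OF u(1), of u'] u' by (simp add: dist_commute)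
        qed
        moreover have "u' \<in> ball u r" using u' by (simp add: dist_commute)
        ultimately show "u' \<in> {u. excess u < b \<and> R \<le> dist u y}"
          using r excess_in[of u'] gap[of u' y] uy by auto
      qed (use u C r R level_sets in auto)
    qed (use R in auto)
    also have "\<dots> \<le> (\<integral>\<^sup>+u. ennreal a \<partial>\<mu>)"
    proof (intro nn_integral_mono_AE)
      show "AE u in \<mu>. ?c u * indicator {u. excess u \<le> a} u \<le> ennreal a"
        using ae
      proof eventually_elim
        case (elim u)
        then show ?case
          using excess_out[of u] excess_in[of u] a_le[of u] gap[of u y] uy
          by (cases "u \<in> C") (auto split: split_indicator intro!: ennreal_leI)
      qed
    qed
    finally show ?thesis by (simp only: const)
  qed
  then have "\<omega> R \<le> a" using a0 by simp
  then show False using a_small \<omega>_pos[OF R] by simp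
qed

text \<open>
  Suppose that the ball around \<open>y\<close> has small mass, and collapse it onto \<open>y\<close>.  The cost is so small that
  nothing is moved by \<open>e\<close> or more.  So the support has no points at intermediate distance from
  \<open>y\<close>, and is split by a gap of width \<open>e\<close>.
\<close>

lemma ball_mass_bounded_below:
  assumes r: "0 < r"
  shows "\<exists>\<theta>>0. \<forall>y\<in>S. \<theta> \<le> measure \<mu> (ball y r)"
proof -
  obtain q where q: "0 < q" "h q < h r" using h_small[of "h r"] h_pos r by auto
  (* The factor \<open>2\<close> leaves a gap of width \<open>e\<close> between the points within \<open>e\<close> of the centre and the others. *)
  define e where "e = q / 2"
  have e: "0 < e" "h (2 * e) < h r" using q by (auto simp: e_def)
  have er: "2 * e < r" using h_less_imp_less[of r "2 * e"] e r by simp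
  (* Mass below \<open>\<omega> e / h r\<close> makes the collapse cost less than \<open>\<omega> e\<close>; mass below \<open>1\<close> leaves points outside. *)
  define \<theta> where "\<theta> = min 1 (\<omega> e / h r)"
  have "\<theta> \<le> measure \<mu> (ball y r)" if y: "y \<in> S" for y
  proof (rule ccontr)
    assume "\<not> ?thesis"
    then have "measure \<mu> (ball y r) < 1" "measure \<mu> (ball y r) < \<omega> e / h r"
      by (simp_all only: \<theta>_def min_le_iff_disj not_le de_Morgan_disj)
    moreover have "0 < h r" using h_pos r by simp
    ultimately have small: "measure \<mu> (ball y r) < 1" "h r * measure \<mu> (ball y r) < \<omega> e"
      by (simp_all add: pos_less_divide_eq mult.commute)
    interpret collapse h \<mu> \<omega> "\<lambda>_. 0" y 0
      by standard (auto intro!: h_nonneg y)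
    have excess: "excess u = h (dist u y)" for u by (simp add: excess_def)
    have not_moved: "\<not> 0 < measure \<mu> {u. excess u < h r \<and> e \<le> dist u y}"
    proof
      assume "0 < measure \<mu> {u. excess u < h r \<and> e \<le> dist u y}"
      then have "ennreal (\<omega> e) \<le> (\<integral>\<^sup>+u\<in>{u. excess u < h r}. ennreal (h (dist u y)) \<partial>\<mu>)"
        using collapse_bound[of "h r" 0 e] h_nonneg[of r] r e by simp
      also have "\<dots> \<le> ennreal (h r + 0) * emeasure \<mu> {u. excess u < h r}"
        by (rule cost_on_sublevel_le) auto
      also have "\<dots> = ennreal (h r * measure \<mu> {u. excess u < h r})"
        using h_nonneg[of r] r by (simp add: emeasure_eq_measure ennreal_mult')
      finally have "\<omega> e \<le> h r * measure \<mu> {u. excess u < h r}"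
        using h_nonneg[of r] r by (subst (asm) ennreal_le_iff) auto
      also have "measure \<mu> {u. excess u < h r} \<le> measure \<mu> (ball y r)"
        using h_less_imp_less[of r] r
        by (intro finite_measure_mono) (auto simp: excess dist_commute)
      then have "h r * measure \<mu> {u. excess u < h r} \<le> h r * measure \<mu> (ball y r)"
        using h_nonneg[of r] r by (intro mult_left_mono) auto
      finally show False using small by simp
    qed
    have alt: "dist u y \<le> e \<or> h r \<le> h (dist u y)" if u: "u \<in> S" for u
    proof (rule ccontr)
      assume *: "\<not> ?thesis"
      have "open {u. h (dist u y) < h r \<and> e < dist u y}"
        by (intro open_Collect_conj open_Collect_less continuous_on_h_dist' continuous_intros)
      moreover have "u \<in> {u. h (dist u y) < h r \<and> e < dist u y}" using * by simp
      ultimately obtain s where s: "0 < s" "ball u s \<subseteq> {u. h (dist u y) < h r \<and> e < dist u y}" by (rule openE)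
      have "0 < measure \<mu> {u. excess u < h r \<and> e \<le> dist u y}"
      proof (rule measure_pos_near[OF u s(1)])
        fix u' assume "u' \<in> S" "dist u' u < s"
        then have "u' \<in> ball u s" by (simp add: dist_commute)
        then show "u' \<in> {u. excess u < h r \<and> e \<le> dist u y}" using s(2) by (auto simp: excess)
      qed (use level_sets in auto)
      with not_moved show False by simp
    qed
    define C where "C = S \<inter> cball y e"
    have "C \<in> sets borel" unfolding C_def by auto
    have "C \<noteq> S"
    proof
      assume "C = S"
      then have "S \<subseteq> cball y e" by (auto simp: C_def)
      then have "S \<subseteq> ball y r" using er e by force
      then have "measure \<mu> S \<le> measure \<mu> (ball y r)" by (intro finite_measure_mono) auto
      then show False using full small by (simp add: emeasure_eq_measure)
    qed
    moreover have "C \<subseteq> S" by (simp add: C_def)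
    ultimately obtain d where d: "d \<in> S - C" by blast
    show False
    proof (rule no_gap[OF \<open>C \<in> sets borel\<close> _ _ d e(1)])
      show "C \<subseteq> S" "y \<in> C" using y e by (auto simp: C_def)
      fix u v assume u: "u \<in> C" and v: "v \<in> S - C"
      then have "v \<in> S" "\<not> dist v y \<le> e" by (simp_all add: C_def dist_commute[of v y])
      then have "h (2 * e) < h (dist v y)" using alt[of v] e by linarith
      then have "2 * e < dist v y" by (rule h_less_imp_less[OF zero_le_dist])
      then show "e \<le> dist u v"
        using u dist_triangle[of v y u] by (simp add: C_def dist_commute)
    qed
  qed
  moreover have "0 < \<theta>" using h_pos r \<omega>_pos[OF e(1)] by (simp add: \<theta>_def)
  ultimately show ?thesis by blast
qed

text \<open>
  Otherwise there would be separated sets of every finite cardinality, and the disjoint balls around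
  their points would have total mass above \<open>1\<close>.
\<close>

lemma supp_totally_bounded:
  assumes r: "0 < r"
  shows "\<exists>k. finite k \<and> S \<subseteq> (\<Union>x\<in>k. ball x r)"
proof (rule ccontr)
  assume no: "\<not> ?thesis"
  obtain \<theta> where \<theta>: "0 < \<theta>" "\<And>y. y \<in> S \<Longrightarrow> \<theta> \<le> measure \<mu> (ball y (r/2))"
    using ball_mass_bounded_below[of "r/2"] r by auto
  have "\<exists>F. finite F \<and> F \<subseteq> S \<and> card F = n \<and> (\<forall>x\<in>F. \<forall>y\<in>F. x \<noteq> y \<longrightarrow> r \<le> dist x y)" for n
  proof (induction n)
    case 0
    show ?case by (intro exI[of _ "{}"]) auto
  next
    case (Suc n)
    then obtain F where F: "finite F" "F \<subseteq> S" "card F = n" "\<forall>x\<in>F. \<forall>y\<in>F. x \<noteq> y \<longrightarrow> r \<le> dist x y"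
      by blast
    obtain z where z: "z \<in> S" "z \<notin> (\<Union>x\<in>F. ball x r)" using no F(1) by blast
    then have "z \<notin> F" using r by force
    then show ?case
      using F z by (intro exI[of _ "insert z F"]) (auto simp: not_less dist_commute)
  qed
  from this[of "nat \<lceil>1 / \<theta>\<rceil> + 1"]
  obtain F where F: "finite F" "F \<subseteq> S" "card F = nat \<lceil>1 / \<theta>\<rceil> + 1"
    "\<forall>x\<in>F. \<forall>y\<in>F. x \<noteq> y \<longrightarrow> r \<le> dist x y" by (elim exE conjE)
  have disj: "disjoint_family_on (\<lambda>x. ball x (r/2)) F"
    unfolding disjoint_family_on_def
  proof (intro ballI impI)
    fix x y assume xy: "x \<in> F" "y \<in> F" "x \<noteq> y"
    then have "r \<le> dist x y" using F by auto
    then show "ball x (r/2) \<inter> ball y (r/2) = {}"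
      by (intro disjoint_ballI) auto
  qed
  have "real (card F) * \<theta> = (\<Sum>x\<in>F. \<theta>)" by simp
  also have "\<dots> \<le> (\<Sum>x\<in>F. measure \<mu> (ball x (r/2)))" using F \<theta> by (intro sum_mono) auto
  also have "\<dots> = measure \<mu> (\<Union>x\<in>F. ball x (r/2))"
    using F disj by (intro finite_measure_finite_Union[symmetric]) auto
  also have "\<dots> \<le> 1" by (rule prob_le_1)
  finally have "real (card F) \<le> 1 / \<theta>" using \<theta> by (simp add: field_simps)
  moreover have "1 / \<theta> < real (card F)" unfolding F(3) using \<theta>(1) by linarith
  ultimately show False by simp
qed

end

lemma compact_supp_of_linfty_bound:
  fixes \<mu> :: "'a::complete_space measure"
  assumes "linfty_bound h \<mu> \<omega>"
  shows "compact (supp \<mu>)"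
proof -
  interpret linfty_bound h \<mu> \<omega> by fact
  show ?thesis
    unfolding compact_eq_totally_bounded
    using supp_totally_bounded closed_supp[OF prob] by (auto simp: complete_eq_closed)
qed

section \<open>The chain condition on the support\<close>

text \<open>
  The largest pseudometric on \<open>A\<close> that is dominated by the cost.
\<close>

definition (in cost_function) chain_dist :: "'a::metric_space set \<Rightarrow> 'a \<Rightarrow> 'a \<Rightarrow> real" where
  "chain_dist A u v = Inf {\<Sum>i=0..N. h (dist (z i) (z (i + 1))) | N z. is_chain A u v N z}"

context cost_function
begin

lemma chain_dist_bdd: "bdd_below {\<Sum>i=0..N. h (dist (z i) (z (i + 1))) | N z. is_chain A u v N z}"
  by (auto intro!: bdd_belowI[of _ 0] sum_nonneg h_nonneg)

lemma chain_dist_le: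
  "is_chain A u v N z \<Longrightarrow> chain_dist A u v \<le> (\<Sum>i=0..N. h (dist (z i) (z (i + 1))))"
  unfolding chain_dist_def by (intro cInf_lower chain_dist_bdd) auto

lemma is_chain_direct: "u \<in> A \<Longrightarrow> v \<in> A \<Longrightarrow> is_chain A u v 0 (\<lambda>i. if i = 0 then u else v)"
  by (auto simp: is_chain_def)

lemma chain_dist_greatest:
  assumes "u \<in> A" "v \<in> A"
    and "\<And>N z. is_chain A u v N z \<Longrightarrow> c \<le> (\<Sum>i=0..N. h (dist (z i) (z (i + 1))))"
  shows "c \<le> chain_dist A u v"
  unfolding chain_dist_def using is_chain_direct[OF assms(1,2)] assms(3)
  by (intro cInf_greatest) auto

lemma chain_dist_nonneg: "u \<in> A \<Longrightarrow> v \<in> A \<Longrightarrow> 0 \<le> chain_dist A u v"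
  by (rule chain_dist_greatest) (auto intro!: sum_nonneg h_nonneg)

lemma chain_dist_le_h: "u \<in> A \<Longrightarrow> v \<in> A \<Longrightarrow> chain_dist A u v \<le> h (dist u v)"
  using chain_dist_le[OF is_chain_direct[of u A v]] by simp

lemma chain_dist_step:
  assumes "u \<in> A" "v \<in> A" "y \<in> A"
  shows "chain_dist A u y - chain_dist A v y \<le> h (dist u v)"
proof -
  have "chain_dist A u y - h (dist u v) \<le> chain_dist A v y"
  proof (rule chain_dist_greatest[OF assms(2,3)])
    fix N z assume z: "is_chain A v y N z"
    define z' where "z' i = (case i of 0 \<Rightarrow> u | Suc j \<Rightarrow> z j)" for i
    have "is_chain A u y (Suc N) z'"
      using z assms by (auto simp: is_chain_def z'_def split: nat.split)
    then have "chain_dist A u y \<le> (\<Sum>i=0..Suc N. h (dist (z' i) (z' (i + 1))))" by (rule chain_dist_le)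
    also have "\<dots> = h (dist u v) + (\<Sum>i=0..N. h (dist (z i) (z (i + 1))))"
      using z by (simp add: sum.atLeast0_atMost_Suc_shift z'_def is_chain_def del: sum.cl_ivl_Suc)
    finally show "chain_dist A u y - h (dist u v) \<le> (\<Sum>i=0..N. h (dist (z i) (z (i + 1))))" by simp
  qed
  then show ?thesis by simp
qed

end

context linfty_bound
begin

text \<open>
  For a violating pair the truncated chain distance \<open>f\<close> to \<open>y\<close> satisfies \<open>f x = h (dist x y)\<close>, so that the
  excess is minimal, with value \<open>0\<close>, at both \<open>x\<close> and \<open>y\<close>.  If points other than \<open>y\<close> with excess \<open>0\<close> have
  positive mass, a small fraction of them moves at small cost over a fixed distance.  If not, the
  points with excess below \<open>b\<close> form a neighbourhood of \<open>x\<close>, and the cost of moving them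
  vanishes as \<open>b\<close> tends to \<open>0\<close>.  Either way the estimate fails.
\<close>

lemma chain_condition_supp: "chain_condition h S"
  unfolding chain_condition_def
proof (intro ballI impI, rule ccontr)
  fix x y assume x: "x \<in> S" and y: "y \<in> S" and "x \<noteq> y"
    and no: "\<not> (\<exists>N z. is_chain S x y N z \<and> (\<Sum>i=0..N. h (dist (z i) (z (i + 1)))) < h (dist x y))"
  define f where "f u = (if u \<in> S then min (chain_dist S u y) (h (dist x y)) else 0)" for u
  have lip: "f u - f v \<le> h (dist u v)" if "u \<in> S" "v \<in> S" for u v
    using that chain_dist_step[OF that y] h_nonneg[of "dist u v"] by (auto simp: f_def)
  have f_nonneg: "0 \<le> f u" for u
    using chain_dist_nonneg[OF _ y] h_nonneg by (auto simp: f_def)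
  have fx: "f x = h (dist x y)"
  proof -
    have "h (dist x y) \<le> chain_dist S x y" using no by (intro chain_dist_greatest x y) (auto simp: not_less)
    then show ?thesis using x by (simp add: f_def)
  qed
  have fy: "f y = 0" using chain_dist_le_h[OF y y] f_nonneg[of y] y by (auto simp: f_def h_0)
  interpret collapse h \<mu> \<omega> f y "h (dist x y)"
  proof
    have "continuous_on S f"
      unfolding continuous_on_iff
    proof (intro ballI allI impI)
      fix u e assume u: "u \<in> S" and "0 < (e::real)"
      then obtain d where d: "0 < d" "h d < e" using h_small by blast
      have "dist (f v) (f u) < e" if v: "v \<in> S" "dist v u < d" for v
      proof -
        have "h (dist v u) < e" using h_mono[of "dist v u" d] v d by simp
        then show ?thesis using lip[OF v(1) u] lip[OF u v(1)] by (simp add: dist_real_def abs_less_iff dist_commute)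
      qed
      then show "\<exists>d>0. \<forall>v\<in>S. dist v u < d \<longrightarrow> dist (f v) (f u) < e" using d by blast
    qed
    then have "continuous_on S (\<lambda>u. min (chain_dist S u y) (h (dist x y)))"
      by (rule continuous_on_cong[THEN iffD1, rotated -1]) (auto simp: f_def)
    then show "f \<in> borel_measurable borel"
      unfolding f_def by (intro borel_measurable_continuous_on_if) auto
    show "\<bar>f u\<bar> \<le> h (dist x y)" for u
      using f_nonneg[of u] h_nonneg by (auto simp: f_def)
  qed (use lip y in auto)
  have excess_nonneg: "0 \<le> excess u" if "u \<in> S" for u
    using lip[OF that y] by (simp add: excess_def fy)
  have excess_x: "excess x = 0" by (simp add: excess_def fx)
  have level: "- f y \<le> 0" by (simp add: fy)
  let ?c = "\<lambda>u. ennreal (h (dist u y))"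
  show False
  proof (cases "\<exists>t>0. 0 < measure \<mu> {u. excess u = 0 \<and> t \<le> dist u y}")
    case True
    then obtain t where t: "0 < t" "0 < measure \<mu> {u. excess u = 0 \<and> t \<le> dist u y}" by blast
    have "ennreal (\<omega> t) \<le> (\<integral>\<^sup>+u\<in>{u. excess u < 0}. ?c u \<partial>\<mu>)"
      using bound_below_level[OF level _ t(2)] t by simp
    also have "\<dots> \<le> (\<integral>\<^sup>+u. 0 \<partial>\<mu>)"
      using AE_S excess_nonneg by (intro nn_integral_mono_AE) (auto elim!: eventually_mono simp: not_less[symmetric] split: split_indicator)
    finally show False using \<omega>_pos[OF t(1)] by (simp add: ennreal_eq_0_iff)
  next
    case False
    have "AE u in \<mu>. u \<notin> {u. excess u = 0 \<and> 1 / real (Suc n) \<le> dist u y}" for n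
    proof (rule AE_notin_of_measure_0[OF _ level_sets(5)])
      have "0 < 1 / real (Suc n)" by simp
      with False show "\<not> 0 < measure \<mu> {u. excess u = 0 \<and> 1 / real (Suc n) \<le> dist u y}" by blast
    qed
    then have ae: "AE u in \<mu>. \<forall>n. u \<notin> {u. excess u = 0 \<and> 1 / real (Suc n) \<le> dist u y}"
      by (simp only: AE_all_countable) blast
    define t where "t = dist x y / 2"
    have t: "0 < t" using \<open>x \<noteq> y\<close> by (simp add: t_def)
    have "ennreal (\<omega> t) \<le> (\<integral>\<^sup>+u\<in>{u. excess u \<le> 0}. ?c u \<partial>\<mu>)"
    proof (rule bound_up_to_level[OF level])
      fix b :: real assume b: "0 < b"
      obtain d where d: "0 < d" "h d < b / 2" using h_small[of "b/2"] b by auto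
      have "open {u. h (dist u y) < h (dist x y) + b / 2}"
        by (intro open_Collect_less continuous_on_h_dist' continuous_intros)
      moreover have "x \<in> {u. h (dist u y) < h (dist x y) + b / 2}" using b by simp
      ultimately obtain r where r: "0 < r" "ball x r \<subseteq> {u. h (dist u y) < h (dist x y) + b / 2}" by (rule openE)
      show "0 < measure \<mu> {u. excess u < b \<and> t \<le> dist u y}"
      proof (rule measure_pos_near[OF x])
        show "0 < min r (min d t)" using r d t by simp
        fix u assume u: "u \<in> S" "dist u x < min r (min d t)"
        have "u \<in> ball x r" using u by (simp add: dist_commute)
        then have "h (dist u y) < h (dist x y) + b / 2" using r by blast
        moreover have "f x - f u < b / 2"
          using lip[OF x u(1)] h_mono[of "dist x u" d] u d by (simp add: dist_commute)
        moreover have "t \<le> dist u y"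
          using dist_triangle[of x y u] u by (simp add: t_def dist_commute)
        ultimately show "u \<in> {u. excess u < b \<and> t \<le> dist u y}" by (simp add: excess_def fx)
      qed (use level_sets in auto)
    qed (use t in auto)
    also have "\<dots> \<le> (\<integral>\<^sup>+u. 0 \<partial>\<mu>)"
    proof (intro nn_integral_mono_AE)
      show "AE u in \<mu>. ?c u * indicator {u. excess u \<le> 0} u \<le> 0"
        using AE_S ae
      proof eventually_elim
        case (elim u)
        show ?case
        proof (cases "excess u \<le> 0")
          case True
          then have excess_0: "excess u = 0" using excess_nonneg[OF elim(1)] by simp
          have "u = y"
          proof (rule ccontr)
            assume "u \<noteq> y"
            then have "0 < dist u y" by simp
            then obtain n where "1 / real (Suc n) < dist u y" using nat_approx_posE by blast
            then show False using elim(2)[rule_format, of n] excess_0 by simp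
          qed
          then show ?thesis by (simp add: h_0)
        qed simp
      qed
    qed
    finally show False using \<omega>_pos[OF t] by (simp add: ennreal_eq_0_iff)
  qed
qed

end

section \<open>The equivalence\<close>

theorem theorem1p2:
  fixes h :: "real \<Rightarrow> real" and \<mu> :: "'a::complete_space measure"
  assumes "mono_on {0..} h" and "continuous_on {0..} h" and "h 0 = 0" and "\<forall>t>0. 0 < h t"
    and "borel_prob \<mu>" and "emeasure \<mu> (supp \<mu>) = 1"
  shows "((compact (supp \<mu>) \<and> chain_condition h (supp \<mu>)) \<longleftrightarrow>
            (\<exists>\<omega>. gauge_fun \<omega> \<and> linfty_estimate h \<mu> \<omega>)) \<and>
         (compact (supp \<mu>) \<and> chain_condition h (supp \<mu>) \<longrightarrow>
            (\<exists>\<rho>. chain_slack h (supp \<mu>) \<rho> \<and> gauge_fun (slack_modulus h \<mu> \<rho>)) \<and>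
            (\<forall>\<rho>. chain_slack h (supp \<mu>) \<rho> \<longrightarrow>
               (\<forall>t>0. 0 < slack_modulus h \<mu> \<rho> t) \<and>
               linfty_estimate h \<mu> (slack_modulus h \<mu> \<rho>)))"
proof -
  interpret cost_function h using assms by unfold_locales
  have ex: "\<exists>\<rho>. chain_slack h (supp \<mu>) \<rho> \<and> gauge_fun (slack_modulus h \<mu> \<rho>)"
    if "compact (supp \<mu>)" "chain_condition h (supp \<mu>)"
    using ex_mono_slack[OF that] gauge_fun_slack_modulus[OF assms(5,6) that(1)] by blast
  have all: "(\<forall>t>0. 0 < slack_modulus h \<mu> \<rho> t) \<and> linfty_estimate h \<mu> (slack_modulus h \<mu> \<rho>)"
    if "compact (supp \<mu>)" "chain_slack h (supp \<mu>) \<rho>" for \<rho>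
    using slack_modulus_pos[OF assms(5,6) that] slack_modulus_estimate[OF assms(5,6) that] by blast
  have conv: "compact (supp \<mu>) \<and> chain_condition h (supp \<mu>)"
    if "gauge_fun \<omega>" "linfty_estimate h \<mu> \<omega>" for \<omega>
  proof -
    interpret linfty_bound h \<mu> \<omega> using assms that by unfold_locales
    show ?thesis
      using compact_supp_of_linfty_bound[OF linfty_bound_axioms] chain_condition_supp by blast
  qed
  show ?thesis using ex all conv by blast
qed

end
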